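(* Let $n\ge 1$ and let $\{L|M\}$ range over all ordered partitions of $\{x_1,\dots,x_n\}$ (i.e. $L\sqcup M=\{x_1,\dots,x_n\}$) with $L\ne\varnothing$. The free left-handed skew Boolean algebra ${}_{\mathcal L}\mathbf{SBA}_n$ on $\{x_1,\dots,x_n\}$ is a direct sum (internal direct product, i.e. orthosum) of the primitive algebras $\mathbf P^{\mathcal L}_{\{L|M\}}$. Thus $${}_{\mathcal L}\mathbf{SBA}_n\simeq \mathbf 1^{\binom n0}\times\mathbf 2^{\binom n1}\times\mathbf 3_L^{\binom n2}\times\mathbf 4_L^{\binom n3}\times\dots\times(\mathbf{n+1})_L^{\binom nn}.$$ Dually, the free right-handed skew Boolean algebra ${}_{\mathcal R}\mathbf{SBA}_n$ on $\{x_1,\dots,x_n\}$ is a direct sum of the primitive algebras $\mathbf P^{\mathcal R}_{\{L|M\}}$. Thus $${}_{\mathcal R}\mathbf{SBA}_n\simeq \mathbf 1^{\binom n0}\times\mathbf 2^{\binom n1}\times\mathbf 3_R^{\binom n2}\times\mathbf 4_R^{\binom n3}\times\dots\times(\mathbf{n+1})_R^{\binom nn}.$$ Finally, the free skew Boolean algebra $\mathbf{SBA}_n$ on $\{x_1,\dots,x_n\}$ is a direct sum of the primitive algebras $\mathbf P^{\mathcal L}_{\{L|M\}}\bullet\mathbf P^{\mathcal R}_{\{L|M\}}$. Thus $$\mathbf{SBA}_n\simeq \mathbf 1^{\binom n0}\times\mathbf 2^{\binom n1}\times(\mathbf 3_L\bullet\mathbf 3_R)^{\binom n2}\times(\mathbf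 4_L\bullet\mathbf 4_R)^{\binom n3}\times\dots\times((\mathbf{n+1})_L\bullet(\mathbf{n+1})_R)^{\binom nn}.$$
   Context: A skew lattice is an algebra $(S;\wedge,\vee)$ with associative binary operations satisfying $x\wedge(x\vee y)=x=(y\vee x)\wedge x$ and $x\vee(x\wedge y)=x=(y\wedge x)\vee x$. A skew Boolean algebra is an algebra $(S;\wedge,\vee,\setminus,0)$ such that $(S;\wedge,\vee)$ is a skew lattice satisfying $x\wedge(y\vee z)=(x\wedge y)\vee(x\wedge z)$ and $(x\vee y)\wedge z=(x\wedge z)\vee(y\wedge z)$, $0$ satisfies $0\wedge x=0=x\wedge 0$ and $0\vee x=x=x\vee 0$, and $(x\wedge y\wedge x)\vee(x\setminus y)=x$, $(x\wedge y\wedge x)\wedge(x\setminus y)=0=(x\setminus y)\wedge(x\wedge y\wedge x)$. It is left-handed if $x\wedge y\wedge x=x\wedge y$ and $x\vee y\vee x=y\vee x$ hold, right-handed if $x\wedge y\wedge x=y\wedge x$ and $x\vee y\vee x=x\vee y$ hold. Each of these classes is a variety, and free algebras are taken in the respective variety. The congruence $\mathcal D$: $x\mathrel{\mathcal D}y$ iff $x\wedge y\wedge x=x$ and $y\wedge x\wedge y=y$. A skew Boolean algebra is primitive if it has exactly two $\mathcal D$-classes, $\{0\}$ and one other. For a nonzero $\mathcal D$-class $D$, $D^0=D\cup\{0\}$ is a primitive subalgebra. Elements $a,b$ are orthogonal if $a\wedge b=0$ (equivalently $b\wedge a=0$); orthogonal elements $\vee$-commute. For pairwise orthogonal nonzero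 $\mathcal D$-classes $D_1,\dots,D_r$, the orthosum $\sum_1^r D_i^0=\{x_1\vee\dots\vee x_r: x_i\in D_i^0\}$ is a subalgebra, the internal direct product of the $D_i^0$. $\mathbf n_L$ is the left-handed algebra on $\{0,1,\dots,n-1\}$ with zero element $0$ and, for nonzero $x,y$: $x\wedge y=x$, $x\vee y=y$, $x\setminus y=0$ (and $x\setminus 0=x$, $0\setminus x=0$). $\mathbf n_R$ is its right-handed dual ($x\wedge y=y$, $x\vee y=x$ for nonzero $x,y$). $\mathbf 1$ is the trivial algebra $\{0\}$ and $\mathbf 2=\mathbf 2_L=\mathbf 2_R$. For primitive algebras $\mathbf P,\mathbf Q$, $\mathbf P\bullet\mathbf Q$ is the fibered product $\mathbf P\times_{\mathbf 2}\mathbf Q$, i.e. the subalgebra of $\mathbf P\times\mathbf Q$ of pairs $(p,q)$ with $p=0\Leftrightarrow q=0$. For an ordered partition $\{L|M\}$ of $\{x_1,\dots,x_n\}$ with $|L|=k\ge1$, $D_{\{L|M\}}$ is the $\mathcal D$-class in ${}_{\mathcal L}\mathbf{SBA}_n$ consisting of the elements $(y_1\wedge\dots\wedge y_k)\setminus(y_{k+1}\vee\dots\vee y_n)$ with $\{y_1,\dots,y_k\}=L$, $\{y_{k+1},\dots,y_n\}=M$ (meaning $y_1\wedge\dots\wedge y_n$ if $k=n$); $\mathbf P^{\mathcal L}_{\{L|M\}}=D_{\{L|M\}}^0$; and $\mathbf P^{\mathcal R}_{\{L|M\}}$ is the analogous primitive subalgebra of ${}_{\mathcal R}\mathbf{SBA}_n$.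 *)

theory Defs
  imports "HOL-Library.FuncSet" "HOL-Algebra.Congruence"
begin

section \<open>Skew Boolean algebras\<close>

record 'a sba = "'a partial_object" +
  smeet :: "'a \<Rightarrow> 'a \<Rightarrow> 'a"  (infixl \<open>\<sqinter>\<index>\<close> 70)
  sjoin :: "'a \<Rightarrow> 'a \<Rightarrow> 'a"  (infixl \<open>\<squnion>\<index>\<close> 65)
  sdiff :: "'a \<Rightarrow> 'a \<Rightarrow> 'a"  (infixl \<open>\<setminus>\<index>\<close> 65)
  szero :: 'a  (\<open>\<zero>\<index>\<close>)

locale skew_lattice =
  fixes S :: "('a, 'm) sba_scheme" (structure)
  assumes meet_closed: "x \<in> carrier S \<Longrightarrow> y \<in> carrier S \<Longrightarrow> x \<sqinter> y \<in> carrier S"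
    and join_closed: "x \<in> carrier S \<Longrightarrow> y \<in> carrier S \<Longrightarrow> x \<squnion> y \<in> carrier S"
    and meet_assoc: "x \<in> carrier S \<Longrightarrow> y \<in> carrier S \<Longrightarrow> z \<in> carrier S \<Longrightarrow>
      (x \<sqinter> y) \<sqinter> z = x \<sqinter> (y \<sqinter> z)"
    and join_assoc: "x \<in> carrier S \<Longrightarrow> y \<in> carrier S \<Longrightarrow> z \<in> carrier S \<Longrightarrow>
      (x \<squnion> y) \<squnion> z = x \<squnion> (y \<squnion> z)"
    and meet_absorb1: "x \<in> carrier S \<Longrightarrow> y \<in> carrier S \<Longrightarrow> x \<sqinter> (x \<squnion> y) = x"
    and meet_absorb2: "x \<in> carrier S \<Longrightarrow> y \<in> carrier S \<Longrightarrow> (y \<squnion> x) \<sqinter> x = x"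
    and join_absorb1: "x \<in> carrier S \<Longrightarrow> y \<in> carrier S \<Longrightarrow> x \<squnion> (x \<sqinter> y) = x"
    and join_absorb2: "x \<in> carrier S \<Longrightarrow> y \<in> carrier S \<Longrightarrow> (y \<sqinter> x) \<squnion> x = x"

locale skew_boolean_algebra = skew_lattice +
  assumes diff_closed: "x \<in> carrier S \<Longrightarrow> y \<in> carrier S \<Longrightarrow> x \<setminus> y \<in> carrier S"
    and zero_closed: "\<zero> \<in> carrier S"
    and distrib_left: "x \<in> carrier S \<Longrightarrow> y \<in> carrier S \<Longrightarrow> z \<in> carrier S \<Longrightarrow>
      x \<sqinter> (y \<squnion> z) = (x \<sqinter> y) \<squnion> (x \<sqinter> z)"
    and distrib_right: "x \<in> carrier S \<Longrightarrow> y \<in> carrier S \<Longrightarrow> z \<in> carrier S \<Longrightarrow>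
      (x \<squnion> y) \<sqinter> z = (x \<sqinter> z) \<squnion> (y \<sqinter> z)"
    and zero_meet: "x \<in> carrier S \<Longrightarrow> \<zero> \<sqinter> x = \<zero>"
    and meet_zero: "x \<in> carrier S \<Longrightarrow> x \<sqinter> \<zero> = \<zero>"
    and zero_join: "x \<in> carrier S \<Longrightarrow> \<zero> \<squnion> x = x"
    and join_zero: "x \<in> carrier S \<Longrightarrow> x \<squnion> \<zero> = x"
    and diff_join: "x \<in> carrier S \<Longrightarrow> y \<in> carrier S \<Longrightarrow> (x \<sqinter> y \<sqinter> x) \<squnion> (x \<setminus> y) = x"
    and diff_meet1: "x \<in> carrier S \<Longrightarrow> y \<in> carrier S \<Longrightarrow> (x \<sqinter> y \<sqinter> x) \<sqinter> (x \<setminus> y) = \<zero>"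
    and diff_meet2: "x \<in> carrier S \<Longrightarrow> y \<in> carrier S \<Longrightarrow> (x \<setminus> y) \<sqinter> (x \<sqinter> y \<sqinter> x) = \<zero>"

locale left_handed_sba = skew_boolean_algebra +
  assumes left_meet: "x \<in> carrier S \<Longrightarrow> y \<in> carrier S \<Longrightarrow> x \<sqinter> y \<sqinter> x = x \<sqinter> y"
    and left_join: "x \<in> carrier S \<Longrightarrow> y \<in> carrier S \<Longrightarrow> x \<squnion> y \<squnion> x = y \<squnion> x"

locale right_handed_sba = skew_boolean_algebra +
  assumes right_meet: "x \<in> carrier S \<Longrightarrow> y \<in> carrier S \<Longrightarrow> x \<sqinter> y \<sqinter> x = y \<sqinter> x"
    and right_join: "x \<in> carrier S \<Longrightarrow> y \<in> carrier S \<Longrightarrow> x \<squnion> y \<squnion> x = x \<squnion> y"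

definition sba_hom :: "('a, 'm) sba_scheme \<Rightarrow> ('b, 'k) sba_scheme \<Rightarrow> ('a \<Rightarrow> 'b) set" where
  "sba_hom S T = {h. h \<in> carrier S \<rightarrow> carrier T \<and>
     (\<forall>x\<in>carrier S. \<forall>y\<in>carrier S. h (x \<sqinter>\<^bsub>S\<^esub> y) = h x \<sqinter>\<^bsub>T\<^esub> h y) \<and>
     (\<forall>x\<in>carrier S. \<forall>y\<in>carrier S. h (x \<squnion>\<^bsub>S\<^esub> y) = h x \<squnion>\<^bsub>T\<^esub> h y) \<and>
     (\<forall>x\<in>carrier S. \<forall>y\<in>carrier S. h (x \<setminus>\<^bsub>S\<^esub> y) = h x \<setminus>\<^bsub>T\<^esub> h y) \<and>
     h \<zero>\<^bsub>S\<^esub> = \<zero>\<^bsub>T\<^esub>}"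

definition sba_iso :: "('a, 'm) sba_scheme \<Rightarrow> ('b, 'k) sba_scheme \<Rightarrow> ('a \<Rightarrow> 'b) set" where
  "sba_iso S T = {h \<in> sba_hom S T. bij_betw h (carrier S) (carrier T)}"

definition sba_isomorphic :: "('a, 'm) sba_scheme \<Rightarrow> ('b, 'k) sba_scheme \<Rightarrow> bool"
    (infix \<open>\<simeq>\<close> 50) where
  "S \<simeq> T \<longleftrightarrow> sba_iso S T \<noteq> {}"


section \<open>D-classes, primitive algebras and orthosums\<close>

definition D_rel :: "('a, 'm) sba_scheme \<Rightarrow> ('a \<times> 'a) set" where
  "D_rel S = {(x, y). x \<in> carrier S \<and> y \<in> carrier S \<and>
     x \<sqinter>\<^bsub>S\<^esub> y \<sqinter>\<^bsub>S\<^esub> x = x \<and> y \<sqinter>\<^bsub>S\<^esub> x \<sqinter>\<^bsub>S\<^esub> y = y}"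

definition nonzero_D_class :: "('a, 'm) sba_scheme \<Rightarrow> 'a set \<Rightarrow> bool" where
  "nonzero_D_class S D \<longleftrightarrow> D \<in> carrier S // D_rel S \<and> D \<noteq> {\<zero>\<^bsub>S\<^esub>}"

definition primitive :: "('a, 'm) sba_scheme \<Rightarrow> bool" where
  "primitive S \<longleftrightarrow> skew_boolean_algebra S \<and>
     (\<exists>D. D \<noteq> {\<zero>\<^bsub>S\<^esub>} \<and> carrier S // D_rel S = {{\<zero>\<^bsub>S\<^esub>}, D})"

definition with_zero :: "('a, 'm) sba_scheme \<Rightarrow> 'a set \<Rightarrow> ('a, 'm) sba_scheme" where
  "with_zero S D = S\<lparr>carrier := insert \<zero>\<^bsub>S\<^esub> D\<rparr>"

definition orthogonal :: "('a, 'm) sba_scheme \<Rightarrow> 'a set \<Rightarrow> 'a set \<Rightarrow> bool" where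
  "orthogonal S A B \<longleftrightarrow> (\<forall>a\<in>A. \<forall>b\<in>B. a \<sqinter>\<^bsub>S\<^esub> b = \<zero>\<^bsub>S\<^esub>)"

fun joins :: "('a, 'm) sba_scheme \<Rightarrow> 'a list \<Rightarrow> 'a" where
  "joins S [] = \<zero>\<^bsub>S\<^esub>"
| "joins S (x # xs) = x \<squnion>\<^bsub>S\<^esub> joins S xs"

definition orthosum :: "('a, 'm) sba_scheme \<Rightarrow> 'a set list \<Rightarrow> 'a set" where
  "orthosum S Ds = {joins S xs |xs. list_all2 (\<lambda>x D. x \<in> carrier (with_zero S D)) xs Ds}"

definition sba_prod :: "'i set \<Rightarrow> ('i \<Rightarrow> 'a sba) \<Rightarrow> ('i \<Rightarrow> 'a) sba" where
  "sba_prod I A = \<lparr>carrier = (\<Pi>\<^sub>E i\<in>I. carrier (A i)),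
     smeet = (\<lambda>f g. \<lambda>i\<in>I. f i \<sqinter>\<^bsub>A i\<^esub> g i),
     sjoin = (\<lambda>f g. \<lambda>i\<in>I. f i \<squnion>\<^bsub>A i\<^esub> g i),
     sdiff = (\<lambda>f g. \<lambda>i\<in>I. f i \<setminus>\<^bsub>A i\<^esub> g i),
     szero = (\<lambda>i\<in>I. \<zero>\<^bsub>A i\<^esub>)\<rparr>"

text \<open>
  The algebra \<open>S\<close> is the orthosum, and thereby the internal direct product, of the primitive
  subalgebras \<open>D i\<close> with zero adjoined. An orthosum is a join over a list; the requirement is made
  for every ordering of the index set.
\<close>

definition is_direct_sum :: "'a sba \<Rightarrow> 'i set \<Rightarrow> ('i \<Rightarrow> 'a set) \<Rightarrow> bool" where
  "is_direct_sum S I D \<longleftrightarrow> finite I \<and>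
     (\<forall>i\<in>I. nonzero_D_class S (D i)) \<and>
     (\<forall>i\<in>I. \<forall>j\<in>I. i \<noteq> j \<longrightarrow> orthogonal S (D i) (D j)) \<and>
     (\<forall>is. distinct is \<and> set is = I \<longrightarrow>
        carrier S = orthosum S (map D is) \<and>
        (\<lambda>f. joins S (map f is)) \<in> sba_iso (sba_prod I (\<lambda>i. with_zero S (D i))) S)"


section \<open>Standard algebras and constructions\<close>

text \<open>The algebra \<open>\<^bold>n\<^sub>L\<close> and its dual \<open>\<^bold>n\<^sub>R\<close>; for \<open>n = 1\<close> both are the trivial algebra.\<close>

definition prim_left :: "nat \<Rightarrow> nat sba" where
  "prim_left n = \<lparr>carrier = {..<n},
     smeet = (\<lambda>x y. if x = 0 \<or> y = 0 then 0 else x),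
     sjoin = (\<lambda>x y. if y = 0 then x else y),
     sdiff = (\<lambda>x y. if y = 0 then x else 0),
     szero = 0\<rparr>"

definition prim_right :: "nat \<Rightarrow> nat sba" where
  "prim_right n = \<lparr>carrier = {..<n},
     smeet = (\<lambda>x y. if x = 0 \<or> y = 0 then 0 else y),
     sjoin = (\<lambda>x y. if x = 0 then y else x),
     sdiff = (\<lambda>x y. if y = 0 then x else 0),
     szero = 0\<rparr>"

abbreviation alg_one :: "nat sba" where "alg_one \<equiv> prim_left 1"

abbreviation alg_two :: "nat sba" where "alg_two \<equiv> prim_left 2"

lemma prim_right_1: "prim_right 1 \<simeq> alg_one"
proof -
  have "id \<in> sba_iso (prim_right 1) alg_one"
    by (auto simp: sba_iso_def sba_hom_def prim_left_def prim_right_def bij_betw_def)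
  then show ?thesis by (auto simp: sba_isomorphic_def)
qed

lemma prim_right_2: "prim_right 2 \<simeq> alg_two"
proof -
  have "id \<in> sba_iso (prim_right 2) alg_two"
    by (auto simp: sba_iso_def sba_hom_def prim_left_def prim_right_def bij_betw_def)
  then show ?thesis by (auto simp: sba_isomorphic_def)
qed

lemma left_handed_prim_left: "n \<ge> 1 \<Longrightarrow> left_handed_sba (prim_left n)"
  by unfold_locales (auto simp: prim_left_def split: if_splits)

lemma right_handed_prim_right: "n \<ge> 1 \<Longrightarrow> right_handed_sba (prim_right n)"
  by unfold_locales (auto simp: prim_right_def split: if_splits)

definition sba_times :: "'a sba \<Rightarrow> 'b sba \<Rightarrow> ('a \<times> 'b) sba"  (infixr \<open>\<times>\<^sub>S\<close> 65) where
  "A \<times>\<^sub>S B = \<lparr>carrier = carrier A \<times> carrier B,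
     smeet = (\<lambda>(a, b) (c, d). (a \<sqinter>\<^bsub>A\<^esub> c, b \<sqinter>\<^bsub>B\<^esub> d)),
     sjoin = (\<lambda>(a, b) (c, d). (a \<squnion>\<^bsub>A\<^esub> c, b \<squnion>\<^bsub>B\<^esub> d)),
     sdiff = (\<lambda>(a, b) (c, d). (a \<setminus>\<^bsub>A\<^esub> c, b \<setminus>\<^bsub>B\<^esub> d)),
     szero = (\<zero>\<^bsub>A\<^esub>, \<zero>\<^bsub>B\<^esub>)\<rparr>"

definition fibered :: "'a sba \<Rightarrow> 'b sba \<Rightarrow> ('a \<times> 'b) sba"  (infixl \<open>\<bullet>\<close> 75) where
  "P \<bullet> Q = (P \<times>\<^sub>S Q)\<lparr>carrier :=
     {(p, q). p \<in> carrier P \<and> q \<in> carrier Q \<and> (p = \<zero>\<^bsub>P\<^esub> \<longleftrightarrow> q = \<zero>\<^bsub>Q\<^esub>)}\<rparr>"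

definition sba_power :: "'a sba \<Rightarrow> nat \<Rightarrow> (nat \<Rightarrow> 'a) sba" where
  "sba_power A m = sba_prod {..<m} (\<lambda>_. A)"


section \<open>Free algebras\<close>

datatype (vars: 'v) sterm =
    Var 'v
  | Meet "'v sterm" "'v sterm"
  | Join "'v sterm" "'v sterm"
  | Diff "'v sterm" "'v sterm"
  | Zero

definition term_alg :: "'v set \<Rightarrow> 'v sterm sba" where
  "term_alg X = \<lparr>carrier = {t. vars t \<subseteq> X},
     smeet = Meet, sjoin = Join, sdiff = Diff, szero = Zero\<rparr>"

definition sba_congruence :: "'a sba \<Rightarrow> ('a \<times> 'a) set \<Rightarrow> bool" where
  "sba_congruence A \<theta> \<longleftrightarrow> equiv (carrier A) \<theta> \<and>
     (\<forall>a b c d. (a, b) \<in> \<theta> \<longrightarrow> (c, d) \<in> \<theta> \<longrightarrow>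
        (a \<sqinter>\<^bsub>A\<^esub> c, b \<sqinter>\<^bsub>A\<^esub> d) \<in> \<theta> \<and>
        (a \<squnion>\<^bsub>A\<^esub> c, b \<squnion>\<^bsub>A\<^esub> d) \<in> \<theta> \<and>
        (a \<setminus>\<^bsub>A\<^esub> c, b \<setminus>\<^bsub>A\<^esub> d) \<in> \<theta>)"

definition sba_quot :: "'a sba \<Rightarrow> ('a \<times> 'a) set \<Rightarrow> 'a set sba" where
  "sba_quot A \<theta> = \<lparr>carrier = carrier A // \<theta>,
     smeet = (\<lambda>U V. \<Union>a\<in>U. \<Union>b\<in>V. \<theta> `` {a \<sqinter>\<^bsub>A\<^esub> b}),
     sjoin = (\<lambda>U V. \<Union>a\<in>U. \<Union>b\<in>V. \<theta> `` {a \<squnion>\<^bsub>A\<^esub> b}),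
     sdiff = (\<lambda>U V. \<Union>a\<in>U. \<Union>b\<in>V. \<theta> `` {a \<setminus>\<^bsub>A\<^esub> b}),
     szero = \<theta> `` {\<zero>\<^bsub>A\<^esub>}\<rparr>"

text \<open>
  The free algebra on \<open>X\<close> in a variety \<open>V\<close> is the term algebra on \<open>X\<close> modulo the intersection of all
  congruences whose quotient belongs to \<open>V\<close> (Burris and Sankappanavar, Definition II.10.9). For the
  three varieties below, membership and the universal property are proved at the end of this
  section.
\<close>

definition free_cong :: "('v sterm set sba \<Rightarrow> bool) \<Rightarrow> 'v set \<Rightarrow> ('v sterm \<times> 'v sterm) set" where
  "free_cong V X = {(s, t). s \<in> carrier (term_alg X) \<and> t \<in> carrier (term_alg X) \<and>
     (\<forall>\<theta>. sba_congruence (term_alg X) \<theta> \<and> V (sba_quot (term_alg X) \<theta>) \<longrightarrow> (s, t) \<in> \<theta>)}"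

definition free_alg :: "('v sterm set sba \<Rightarrow> bool) \<Rightarrow> 'v set \<Rightarrow> 'v sterm set sba" where
  "free_alg V X = sba_quot (term_alg X) (free_cong V X)"

definition free_gen :: "('v sterm set sba \<Rightarrow> bool) \<Rightarrow> 'v set \<Rightarrow> 'v \<Rightarrow> 'v sterm set" where
  "free_gen V X x = free_cong V X `` {Var x}"

abbreviation free_sba :: "'v set \<Rightarrow> 'v sterm set sba" where
  "free_sba \<equiv> free_alg skew_boolean_algebra"

abbreviation free_left_sba :: "'v set \<Rightarrow> 'v sterm set sba" where
  "free_left_sba \<equiv> free_alg left_handed_sba"

abbreviation free_right_sba :: "'v set \<Rightarrow> 'v sterm set sba" where
  "free_right_sba \<equiv> free_alg right_handed_sba"

locale closed_algebra =
  fixes A :: "'a sba" (structure)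
  assumes closed: "x \<in> carrier A \<Longrightarrow> y \<in> carrier A \<Longrightarrow> x \<sqinter> y \<in> carrier A"
    "x \<in> carrier A \<Longrightarrow> y \<in> carrier A \<Longrightarrow> x \<squnion> y \<in> carrier A"
    "x \<in> carrier A \<Longrightarrow> y \<in> carrier A \<Longrightarrow> x \<setminus> y \<in> carrier A"
    "\<zero> \<in> carrier A"

lemma closed_term_alg: "closed_algebra (term_alg X)"
  by unfold_locales (auto simp: term_alg_def)

lemma UN_class_eq:
  assumes eq: "equiv A \<theta>"
    and cong: "\<And>a b c d. (a, b) \<in> \<theta> \<Longrightarrow> (c, d) \<in> \<theta> \<Longrightarrow> (f a c, f b d) \<in> \<theta>"
    and ab: "a \<in> A" "b \<in> A"
  shows "(\<Union>x\<in>\<theta> `` {a}. \<Union>y\<in>\<theta> `` {b}. \<theta> `` {f x y}) = \<theta> `` {f a b}"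
proof -
  have "\<theta> `` {f x y} = \<theta> `` {f a b}" if "x \<in> \<theta> `` {a}" "y \<in> \<theta> `` {b}" for x y
    using that cong[of a x b y] equiv_class_eq[OF eq] by auto
  moreover have "a \<in> \<theta> `` {a}" "b \<in> \<theta> `` {b}"
    using ab eq by (auto simp: equiv_def refl_on_def)
  ultimately show ?thesis by blast
qed

lemma quot_simps:
  assumes "sba_congruence A \<theta>" "a \<in> carrier A" "b \<in> carrier A"
  shows "\<theta> `` {a} \<sqinter>\<^bsub>sba_quot A \<theta>\<^esub> \<theta> `` {b} = \<theta> `` {a \<sqinter>\<^bsub>A\<^esub> b}"
    and "\<theta> `` {a} \<squnion>\<^bsub>sba_quot A \<theta>\<^esub> \<theta> `` {b} = \<theta> `` {a \<squnion>\<^bsub>A\<^esub> b}"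
    and "\<theta> `` {a} \<setminus>\<^bsub>sba_quot A \<theta>\<^esub> \<theta> `` {b} = \<theta> `` {a \<setminus>\<^bsub>A\<^esub> b}"
  using assms by (simp_all add: sba_quot_def) (rule UN_class_eq; auto simp: sba_congruence_def)+

lemma quot_carrier: "carrier (sba_quot A \<theta>) = (\<lambda>a. \<theta> `` {a}) ` carrier A"
  by (auto simp: sba_quot_def quotient_def)

lemma quot_zero: "\<zero>\<^bsub>sba_quot A \<theta>\<^esub> = \<theta> `` {\<zero>\<^bsub>A\<^esub>}"
  by (simp add: sba_quot_def)

lemma quot_eq_iff:
  assumes "sba_congruence A \<theta>" "a \<in> carrier A" "b \<in> carrier A"
  shows "\<theta> `` {a} = \<theta> `` {b} \<longleftrightarrow> (a, b) \<in> \<theta>"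
  using assms eq_equiv_class_iff[of "carrier A" \<theta>] by (auto simp: sba_congruence_def)

lemma all_image:
  "(\<forall>x. x \<in> f ` A \<longrightarrow> P x) = (\<forall>x\<in>A. P (f x))"
  "(\<forall>x y. x \<in> f ` A \<longrightarrow> y \<in> f ` A \<longrightarrow> Q x y) = (\<forall>x\<in>A. \<forall>y\<in>A. Q (f x) (f y))"
  "(\<forall>x y z. x \<in> f ` A \<longrightarrow> y \<in> f ` A \<longrightarrow> z \<in> f ` A \<longrightarrow> R x y z) =
     (\<forall>x\<in>A. \<forall>y\<in>A. \<forall>z\<in>A. R (f x) (f y) (f z))"
  by blast+

lemmas variety_defs = skew_lattice_def skew_boolean_algebra_def skew_boolean_algebra_axioms_def
  left_handed_sba_def left_handed_sba_axioms_def right_handed_sba_def right_handed_sba_axioms_def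

lemma equiv_free_cong: "equiv (carrier (term_alg X)) (free_cong V X)"
  unfolding equiv_def
proof (intro conjI)
  show "free_cong V X \<subseteq> carrier (term_alg X) \<times> carrier (term_alg X)"
    by (auto simp: free_cong_def)
  show "refl_on (carrier (term_alg X)) (free_cong V X)"
    by (auto simp: free_cong_def refl_on_def sba_congruence_def equiv_def)
  show "sym (free_cong V X)"
    by (auto simp: free_cong_def sba_congruence_def equiv_def intro!: symI elim: symE)
  show "trans (free_cong V X)"
    unfolding free_cong_def sba_congruence_def equiv_def by (rule transI) (auto elim: transE)
qed

lemma congruence_free_cong: "sba_congruence (term_alg X) (free_cong V X)"
  unfolding sba_congruence_def
proof (intro conjI equiv_free_cong allI impI)
  interpret closed_algebra "term_alg X" by (rule closed_term_alg)
  fix a b c d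
  assume "(a, b) \<in> free_cong V X" "(c, d) \<in> free_cong V X"
  then show
    "(a \<sqinter>\<^bsub>term_alg X\<^esub> c, b \<sqinter>\<^bsub>term_alg X\<^esub> d) \<in> free_cong V X"
    "(a \<squnion>\<^bsub>term_alg X\<^esub> c, b \<squnion>\<^bsub>term_alg X\<^esub> d) \<in> free_cong V X"
    "(a \<setminus>\<^bsub>term_alg X\<^esub> c, b \<setminus>\<^bsub>term_alg X\<^esub> d) \<in> free_cong V X"
    by (auto simp: free_cong_def closed sba_congruence_def)
qed

lemma free_in_variety:
  fixes X :: "'v set"
  shows "skew_boolean_algebra (free_sba X)"
    and "left_handed_sba (free_left_sba X)"
    and "right_handed_sba (free_right_sba X)"
proof -
  interpret closed_algebra "term_alg X" by (rule closed_term_alg)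
  have *: "V (sba_quot (term_alg X) (free_cong V X))"
    if "\<And>\<Theta>. sba_congruence (term_alg X) \<Theta> \<Longrightarrow>
          (\<And>s t. s \<in> carrier (term_alg X) \<Longrightarrow> t \<in> carrier (term_alg X) \<Longrightarrow>
             (\<And>\<theta>. sba_congruence (term_alg X) \<theta> \<Longrightarrow> V (sba_quot (term_alg X) \<theta>) \<Longrightarrow> (s, t) \<in> \<theta>) \<Longrightarrow>
             (s, t) \<in> \<Theta>) \<Longrightarrow>
          V (sba_quot (term_alg X) \<Theta>)"
    for V
    by (rule that) (rule congruence_free_cong, auto simp: free_cong_def)
  note [simp] = quot_simps quot_eq_iff quot_zero closed
  show "skew_boolean_algebra (free_sba X)"
    unfolding free_alg_def
    by (rule *) (simp add: variety_defs quot_carrier all_image cong: conj_cong ball_cong)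
  show "left_handed_sba (free_left_sba X)"
    unfolding free_alg_def
    by (rule *) (simp add: variety_defs quot_carrier all_image cong: conj_cong ball_cong)
  show "right_handed_sba (free_right_sba X)"
    unfolding free_alg_def
    by (rule *) (simp add: variety_defs quot_carrier all_image cong: conj_cong ball_cong)
qed

primrec sterm_eval :: "('a, 'm) sba_scheme \<Rightarrow> ('v \<Rightarrow> 'a) \<Rightarrow> 'v sterm \<Rightarrow> 'a" where
  "sterm_eval B f (Var x) = f x"
| "sterm_eval B f (Meet s t) = sterm_eval B f s \<sqinter>\<^bsub>B\<^esub> sterm_eval B f t"
| "sterm_eval B f (Join s t) = sterm_eval B f s \<squnion>\<^bsub>B\<^esub> sterm_eval B f t"
| "sterm_eval B f (Diff s t) = sterm_eval B f s \<setminus>\<^bsub>B\<^esub> sterm_eval B f t"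
| "sterm_eval B f Zero = \<zero>\<^bsub>B\<^esub>"

definition eval_kernel where
  "eval_kernel B f X = {(s, t). s \<in> carrier (term_alg X) \<and> t \<in> carrier (term_alg X) \<and>
     sterm_eval B f s = sterm_eval B f t}"

lemma congruence_eval_kernel: "sba_congruence (term_alg X) (eval_kernel B f X)"
  by (auto simp: sba_congruence_def eval_kernel_def equiv_def term_alg_def
      intro!: refl_onI symI transI)

lemma eval_closed:
  assumes "skew_boolean_algebra B" "f \<in> X \<rightarrow> carrier B" "t \<in> carrier (term_alg X)"
  shows "sterm_eval B f t \<in> carrier B"
proof -
  interpret skew_boolean_algebra B by fact
  show ?thesis
    using assms(2,3)
    by (induction t)
      (auto simp: term_alg_def meet_closed join_closed diff_closed zero_closed)
qed

lemma eval_term_alg: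
  "sterm_eval B f (s \<sqinter>\<^bsub>term_alg X\<^esub> t) = sterm_eval B f s \<sqinter>\<^bsub>B\<^esub> sterm_eval B f t"
  "sterm_eval B f (s \<squnion>\<^bsub>term_alg X\<^esub> t) = sterm_eval B f s \<squnion>\<^bsub>B\<^esub> sterm_eval B f t"
  "sterm_eval B f (s \<setminus>\<^bsub>term_alg X\<^esub> t) = sterm_eval B f s \<setminus>\<^bsub>B\<^esub> sterm_eval B f t"
  "sterm_eval B f \<zero>\<^bsub>term_alg X\<^esub> = \<zero>\<^bsub>B\<^esub>"
  by (simp_all add: term_alg_def)

lemma quot_eval_kernel:
  fixes X :: "'v set"
  assumes f: "f \<in> X \<rightarrow> carrier B"
  shows "skew_boolean_algebra B \<Longrightarrow>
      skew_boolean_algebra (sba_quot (term_alg X) (eval_kernel B f X))"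
    and "left_handed_sba B \<Longrightarrow> left_handed_sba (sba_quot (term_alg X) (eval_kernel B f X))"
    and "right_handed_sba B \<Longrightarrow> right_handed_sba (sba_quot (term_alg X) (eval_kernel B f X))"
proof -
  interpret T: closed_algebra "term_alg X" by (rule closed_term_alg)
  note K = congruence_eval_kernel[of X B f]
  have mem: "(s, t) \<in> eval_kernel B f X \<longleftrightarrow> sterm_eval B f s = sterm_eval B f t"
    if "s \<in> carrier (term_alg X)" "t \<in> carrier (term_alg X)" for s t
    using that by (simp add: eval_kernel_def)
  note [simp] = quot_simps[OF K] quot_eq_iff[OF K] quot_zero T.closed mem eval_term_alg
  have *: "skew_boolean_algebra (sba_quot (term_alg X) (eval_kernel B f X))"
    if "skew_boolean_algebra B"
  proof -
    interpret skew_boolean_algebra B by fact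
    note [simp] = eval_closed[OF that f]
    show ?thesis
      unfolding skew_boolean_algebra_def skew_boolean_algebra_axioms_def skew_lattice_def
        quot_carrier all_image
      by (simp add: meet_closed join_closed diff_closed zero_closed
          meet_absorb1 meet_absorb2 join_absorb1 join_absorb2 distrib_left distrib_right
          zero_meet meet_zero zero_join join_zero
          diff_join diff_meet1 diff_meet2 cong: ball_cong)
        (simp add: meet_assoc join_assoc)
  qed
  show "skew_boolean_algebra B \<Longrightarrow>
      skew_boolean_algebra (sba_quot (term_alg X) (eval_kernel B f X))"
    by (rule *)
  show "left_handed_sba (sba_quot (term_alg X) (eval_kernel B f X))" if "left_handed_sba B"
  proof -
    interpret left_handed_sba B by fact
    note [simp] = eval_closed[OF skew_boolean_algebra_axioms f]
    show ?thesis
      unfolding left_handed_sba_def left_handed_sba_axioms_def quot_carrier all_image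
      using *[OF skew_boolean_algebra_axioms] by (simp add: left_meet left_join)
  qed
  show "right_handed_sba (sba_quot (term_alg X) (eval_kernel B f X))" if "right_handed_sba B"
  proof -
    interpret right_handed_sba B by fact
    note [simp] = eval_closed[OF skew_boolean_algebra_axioms f]
    show ?thesis
      unfolding right_handed_sba_def right_handed_sba_axioms_def quot_carrier all_image
      using *[OF skew_boolean_algebra_axioms] by (simp add: right_meet right_join)
  qed
qed

text \<open>A homomorphism out of a free algebra is unique on the carrier.\<close>

definition extends_uniquely where
  "extends_uniquely F B g f X \<longleftrightarrow>
     (\<exists>h \<in> sba_hom F B. (\<forall>x\<in>X. h (g x) = f x) \<and>
       (\<forall>h' \<in> sba_hom F B. (\<forall>x\<in>X. h' (g x) = f x) \<longrightarrow> (\<forall>u\<in>carrier F. h' u = h u)))"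

lemma free_extends:
  assumes B: "skew_boolean_algebra B" and f: "f \<in> X \<rightarrow> carrier B"
    and V: "V (sba_quot (term_alg X) (eval_kernel B f X))"
  shows "extends_uniquely (free_alg V X) B (free_gen V X) f X"
proof -
  interpret T: closed_algebra "term_alg X" by (rule closed_term_alg)
  let ?c = "\<lambda>t. free_cong V X `` {t}"
  let ?T = "carrier (term_alg X)"
  note C = congruence_free_cong[of X V]
  have sub: "sterm_eval B f s = sterm_eval B f t" if "(s, t) \<in> free_cong V X" for s t
    using that V congruence_eval_kernel[of X B f] by (auto simp: free_cong_def eval_kernel_def)
  define h where "h U = sterm_eval B f (SOME t. t \<in> U)" for U
  have h: "h (?c t) = sterm_eval B f t" if "t \<in> ?T" for t
  proof -
    have "t \<in> ?c t" using that C by (auto simp: sba_congruence_def equiv_def refl_on_def)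
    then have "(SOME s. s \<in> ?c t) \<in> ?c t" by (rule someI)
    then show ?thesis using sub by (auto simp: h_def)
  qed
  have hom: "h \<in> sba_hom (free_alg V X) B"
    using eval_closed[OF B f]
    by (auto simp: sba_hom_def free_alg_def quot_carrier quot_simps[OF C] quot_zero h T.closed
        eval_term_alg)
  have gen: "h (free_gen V X x) = f x" if "x \<in> X" for x
    using that by (simp add: free_gen_def h term_alg_def)
  have "h' (?c t) = h (?c t)"
    if h': "h' \<in> sba_hom (free_alg V X) B" "\<forall>x\<in>X. h' (free_gen V X x) = f x" and t: "t \<in> ?T"
    for h' t
  proof -
    have step: "h' (?c (a \<sqinter>\<^bsub>term_alg X\<^esub> b)) = h' (?c a) \<sqinter>\<^bsub>B\<^esub> h' (?c b)"
      "h' (?c (a \<squnion>\<^bsub>term_alg X\<^esub> b)) = h' (?c a) \<squnion>\<^bsub>B\<^esub> h' (?c b)"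
      "h' (?c (a \<setminus>\<^bsub>term_alg X\<^esub> b)) = h' (?c a) \<setminus>\<^bsub>B\<^esub> h' (?c b)"
      "h' (?c \<zero>\<^bsub>term_alg X\<^esub>) = \<zero>\<^bsub>B\<^esub>"
      if "a \<in> ?T" "b \<in> ?T" for a b
      using h'(1) that
      by (auto simp: sba_hom_def free_alg_def quot_carrier quot_zero simp flip: quot_simps[OF C])
    have "h' (?c t) = sterm_eval B f t"
      using t
    proof (induction t)
      case (Var x)
      then show ?case using h'(2) by (auto simp: free_gen_def term_alg_def)
    next
      case (Meet s t)
      then show ?case using step(1)[of s t] by (simp add: term_alg_def)
    next
      case (Join s t)
      then show ?case using step(2)[of s t] by (simp add: term_alg_def)
    next
      case (Diff s t)
      then show ?case using step(3)[of s t] by (simp add: term_alg_def)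
    next
      case Zero
      then show ?case using step(4)[of Zero Zero] by (simp add: term_alg_def)
    qed
    with h t show ?thesis by simp
  qed
  then have "\<forall>u\<in>carrier (free_alg V X). h' u = h u"
    if "h' \<in> sba_hom (free_alg V X) B" "\<forall>x\<in>X. h' (free_gen V X x) = f x" for h'
    using that by (auto simp: free_alg_def quot_carrier)
  with hom gen show ?thesis unfolding extends_uniquely_def by blast
qed

lemma free_sba_universal:
  assumes "skew_boolean_algebra B" "f \<in> X \<rightarrow> carrier B"
  shows "extends_uniquely (free_sba X) B (free_gen skew_boolean_algebra X) f X"
  using assms by (intro free_extends quot_eval_kernel)

lemma free_left_sba_universal:
  assumes "left_handed_sba B" "f \<in> X \<rightarrow> carrier B"
  shows "extends_uniquely (free_left_sba X) B (free_gen left_handed_sba X) f X"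
  using assms by (intro free_extends quot_eval_kernel) (auto simp: left_handed_sba_def)

lemma free_right_sba_universal:
  assumes "right_handed_sba B" "f \<in> X \<rightarrow> carrier B"
  shows "extends_uniquely (free_right_sba X) B (free_gen right_handed_sba X) f X"
  using assms by (intro free_extends quot_eval_kernel) (auto simp: right_handed_sba_def)


section \<open>The atomic D-classes of the free algebras\<close>

definition ordered_partitions :: "'v set \<Rightarrow> ('v set \<times> 'v set) set" where
  "ordered_partitions X = {(L, M). L \<union> M = X \<and> L \<inter> M = {} \<and> L \<noteq> {}}"

fun meets :: "('a, 'm) sba_scheme \<Rightarrow> 'a list \<Rightarrow> 'a" where
  "meets S [] = undefined"
| "meets S [x] = x"
| "meets S (x # y # xs) = x \<sqinter>\<^bsub>S\<^esub> meets S (y # xs)"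

text \<open>
  \<open>atom_elem S [y\<^sub>1, \<dots>, y\<^sub>k] [z\<^sub>1, \<dots>, z\<^sub>m]\<close> is the element
  \<open>(y\<^sub>1 \<sqinter> \<dots> \<sqinter> y\<^sub>k) \<setminus> (z\<^sub>1 \<squnion> \<dots> \<squnion> z\<^sub>m)\<close>, read as \<open>y\<^sub>1 \<sqinter> \<dots> \<sqinter> y\<^sub>k\<close> if
  \<open>m = 0\<close>. The class collects these over all enumerations of \<open>L\<close> and \<open>M\<close>; it is only used for
  \<open>L \<noteq> {}\<close>.
\<close>

definition atom_elem :: "('a, 'm) sba_scheme \<Rightarrow> 'a list \<Rightarrow> 'a list \<Rightarrow> 'a" where
  "atom_elem S ys zs = (if zs = [] then meets S ys else meets S ys \<setminus>\<^bsub>S\<^esub> joins S zs)"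

definition atom_class ::
  "('a, 'm) sba_scheme \<Rightarrow> ('v \<Rightarrow> 'a) \<Rightarrow> 'v set \<times> 'v set \<Rightarrow> 'a set" where
  "atom_class S g = (\<lambda>(L, M). {atom_elem S (map g ys) (map g zs) |ys zs.
     distinct ys \<and> set ys = L \<and> distinct zs \<and> set zs = M})"

abbreviation D_left :: "'v set \<Rightarrow> 'v set \<times> 'v set \<Rightarrow> 'v sterm set set" where
  "D_left X \<equiv> atom_class (free_left_sba X) (free_gen left_handed_sba X)"

abbreviation D_right :: "'v set \<Rightarrow> 'v set \<times> 'v set \<Rightarrow> 'v sterm set set" where
  "D_right X \<equiv> atom_class (free_right_sba X) (free_gen right_handed_sba X)"

abbreviation P_left :: "'v set \<Rightarrow> 'v set \<times> 'v set \<Rightarrow> 'v sterm set sba" where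
  "P_left X p \<equiv> with_zero (free_left_sba X) (D_left X p)"

abbreviation P_right :: "'v set \<Rightarrow> 'v set \<times> 'v set \<Rightarrow> 'v sterm set sba" where
  "P_right X p \<equiv> with_zero (free_right_sba X) (D_right X p)"

end

theory Submission
  imports Defs
begin

text \<open>
  In a ring, a central idempotent splits every element into two parts. In a skew Boolean algebra
  every element \<open>a\<close> does the same: \<open>x = (x \<sqinter> a \<sqinter> x) \<squnion> (x \<setminus> a)\<close>, where the first part lies
  below \<open>a\<close> in the natural preorder \<open>\<preceq>\<close>, whose symmetric part is \<open>\<D>\<close>, and the second part is
  orthogonal to \<open>a\<close>. The two distributive laws force the meet to be normal,
  \<open>x \<sqinter> y \<sqinter> z \<sqinter> w = x \<sqinter> z \<sqinter> y \<sqinter> w\<close> (lemma \<open>meet_normal\<close>), and normality makes the splitting unique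
  (lemma \<open>diff_unique\<close>). Hence both \<open>x \<mapsto> x \<sqinter> a \<sqinter> x\<close> and \<open>x \<mapsto> x \<setminus> a\<close> are endomorphisms.

  Let the algebra be generated by \<open>g u\<close>, for \<open>u\<close> in a finite set \<open>X\<close>. Splitting along all
  generators in turn yields one endomorphism for every \<open>L \<subseteq> X\<close> (\<open>cell_map\<close>), just as \<open>n\<close> sets cut
  a Venn diagram into \<open>2\<^sup>n\<close> cells. Together these endomorphisms are injective, each is idempotent,
  and the images of two different ones are orthogonal. The endomorphism for \<open>L\<close> kills the
  generators outside \<open>L\<close> and makes those in \<open>L\<close> \<open>\<D>\<close>-related. Its image is therefore
  \<open>0\<close> together with the rectangular band generated by the images of the \<open>g u\<close>, \<open>u \<in> L\<close>; for
  \<open>L = {}\<close> it is trivial. Thus every finitely generated skew Boolean algebra in which these bands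
  avoid \<open>0\<close> is the orthosum of primitive algebras indexed by the nonempty \<open>L\<close>
  (\<open>direct_sum_components\<close>). The defining element of an atomic class is the image of a meet
  of generators, so it equals a product of band elements; in the left-handed case such
  a product is its first factor, in the right-handed case its last one, and the atomic class
  is the whole band (\<open>atom_class_left_handed\<close>, \<open>atom_class_right_handed\<close>).

  Freeness shows that the bands are as large as possible. A homomorphism that numbers the
  generators in \<open>L\<close> by \<open>1, \<dots>, k\<close>, with \<open>k\<close> the size of \<open>L\<close>, and sends the other generators to \<open>0\<close>
  factors through the cell of \<open>L\<close> (\<open>component_model\<close>). A product of two band elements is
  determined by its first factor (left-handed), its last factor (right-handed) or the pair of
  both (general case), and the numbers recover exactly this information in \<open>prim_left (k + 1)\<close>,
  \<open>prim_right (k + 1)\<close> and the fibered product of the two. Collecting the factors by the size of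
  \<open>L\<close> gives the binomial exponents.
\<close>

section \<open>Arithmetic in a skew Boolean algebra\<close>

context skew_boolean_algebra
begin

lemmas ops_closed [simp, intro] = meet_closed join_closed diff_closed zero_closed
lemmas zero_laws [simp] = zero_meet meet_zero zero_join join_zero

lemma join_idem: "x \<in> carrier S \<Longrightarrow> x \<squnion> x = x"
  by (metis join_absorb1 meet_absorb1 join_closed)

lemma meet_idem [simp]: "x \<in> carrier S \<Longrightarrow> x \<sqinter> x = x"
  by (metis join_idem meet_absorb1)

lemma meet_left_idem [simp]:
  "x \<in> carrier S \<Longrightarrow> y \<in> carrier S \<Longrightarrow> x \<sqinter> (x \<sqinter> y) = x \<sqinter> y"
  by (metis meet_assoc meet_idem)

lemma join_eq_left_iff: "x \<in> carrier S \<Longrightarrow> y \<in> carrier S \<Longrightarrow> x \<squnion> y = x \<longleftrightarrow> x \<sqinter> y = y"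
  by (metis join_absorb1 meet_absorb2)

lemma join_eq_right_iff: "x \<in> carrier S \<Longrightarrow> y \<in> carrier S \<Longrightarrow> x \<squnion> y = y \<longleftrightarrow> x \<sqinter> y = x"
  by (metis join_absorb2 meet_absorb1)

text \<open>
  Elements \<open>u\<close> and \<open>v\<close> below a common bound \<open>a\<close> in the natural partial order commute: expanding
  \<open>(a \<squnion> u) \<sqinter> v\<close> and \<open>v \<sqinter> (u \<squnion> a)\<close> gives \<open>v = v \<squnion> (u \<sqinter> v)\<close> and \<open>v = (v \<sqinter> u) \<squnion> v\<close>, and absorption turns
  these into \<open>v \<sqinter> u \<sqinter> v = u \<sqinter> v\<close> and \<open>v \<sqinter> u \<sqinter> v = v \<sqinter> u\<close>.
\<close>

lemma commute_below:
  assumes a: "a \<in> carrier S" and u: "u \<in> carrier S" "a \<sqinter> u = u" "u \<sqinter> a = u"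
    and v: "v \<in> carrier S" "a \<sqinter> v = v" "v \<sqinter> a = v"
  shows "u \<sqinter> v = v \<sqinter> u"
proof -
  have au: "a \<squnion> u = a" "u \<squnion> a = a"
    using a u by (simp_all add: join_eq_left_iff join_eq_right_iff)
  have "v = (a \<squnion> u) \<sqinter> v" using au v by simp
  also have "\<dots> = v \<squnion> u \<sqinter> v" using a u v by (simp add: distrib_right)
  finally have "v \<sqinter> (u \<sqinter> v) = u \<sqinter> v" using u v by (simp flip: join_eq_left_iff)
  moreover have "v = v \<sqinter> (u \<squnion> a)" using au v by simp
  then have "v = v \<sqinter> u \<squnion> v" using a u v by (simp add: distrib_left)
  then have "v \<sqinter> u \<sqinter> v = v \<sqinter> u" using u v by (simp flip: join_eq_right_iff)
  ultimately show ?thesis using u v by (simp add: meet_assoc)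
qed

text \<open>
  A band in which \<open>x \<sqinter> y \<sqinter> x\<close> and \<open>x \<sqinter> z \<sqinter> x\<close> always commute allows \<open>x\<close> to be inserted inside any
  product that begins and ends with \<open>x\<close>. The trick is to double the factor \<open>z \<sqinter> x \<sqinter> y\<close> in
  \<open>x \<sqinter> z \<sqinter> x \<sqinter> y \<sqinter> x\<close>, which exposes \<open>y \<sqinter> z\<close> between two occurrences of \<open>x\<close>.
\<close>

lemma meet_normal_aux:
  assumes x: "x \<in> carrier S" and y: "y \<in> carrier S" and z: "z \<in> carrier S"
  shows "x \<sqinter> (y \<sqinter> (z \<sqinter> x)) = x \<sqinter> (y \<sqinter> (x \<sqinter> (z \<sqinter> x)))"
proof -
  note [simp] = meet_assoc
  have comm: "x \<sqinter> (u \<sqinter> (x \<sqinter> (v \<sqinter> x))) = x \<sqinter> (v \<sqinter> (x \<sqinter> (u \<sqinter> x)))"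
    if "u \<in> carrier S" "v \<in> carrier S" for u v
    using commute_below[of x "x \<sqinter> (u \<sqinter> x)" "x \<sqinter> (v \<sqinter> x)"] that x by simp
  have i: "u \<sqinter> (v \<sqinter> (u \<sqinter> (v \<sqinter> w))) = u \<sqinter> (v \<sqinter> w)"
    if "u \<in> carrier S" "v \<in> carrier S" "w \<in> carrier S" for u v w
    using that meet_left_idem[of "u \<sqinter> v" w] by simp
  have "x \<sqinter> (y \<sqinter> (x \<sqinter> (z \<sqinter> x))) = x \<sqinter> (z \<sqinter> (x \<sqinter> (y \<sqinter> x)))"
    using comm y z by simp
  also have "\<dots> = x \<sqinter> ((z \<sqinter> x \<sqinter> y) \<sqinter> ((z \<sqinter> x \<sqinter> y) \<sqinter> x))"
    using x y z meet_left_idem[of "z \<sqinter> x \<sqinter> y" x] by simp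
  also have "\<dots> = x \<sqinter> (z \<sqinter> (x \<sqinter> ((y \<sqinter> z) \<sqinter> x))) \<sqinter> (y \<sqinter> x)"
    using x y z by simp
  also have "\<dots> = x \<sqinter> ((y \<sqinter> z) \<sqinter> (x \<sqinter> (z \<sqinter> x))) \<sqinter> (y \<sqinter> x)"
    using comm[of z "y \<sqinter> z"] x y z by simp
  also have "\<dots> = x \<sqinter> ((y \<sqinter> z) \<sqinter> (x \<sqinter> (y \<sqinter> x)))"
    using i[of z x "y \<sqinter> x"] x y z by simp
  also have "\<dots> = x \<sqinter> (y \<sqinter> (x \<sqinter> ((y \<sqinter> z) \<sqinter> x)))"
    using comm[of "y \<sqinter> z" y] x y z by simp
  also have "\<dots> = x \<sqinter> (y \<sqinter> (z \<sqinter> x))"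
    using i[of x y "z \<sqinter> x"] x y z by simp
  finally show ?thesis by simp
qed

text \<open>
  Normality follows by squaring the product: in \<open>x \<sqinter> y \<sqinter> z \<sqinter> w \<sqinter> x \<sqinter> y \<sqinter> z \<sqinter> w\<close> both copies of
  \<open>y \<sqinter> z\<close> lie between equal letters, the second between two \<open>w\<close>, the first between two \<open>x\<close>, where
  everything commutes.
\<close>

lemma meet_normal:
  assumes x: "x \<in> carrier S" and y: "y \<in> carrier S" and z: "z \<in> carrier S"
    and w: "w \<in> carrier S"
  shows "x \<sqinter> (y \<sqinter> (z \<sqinter> w)) = x \<sqinter> (z \<sqinter> (y \<sqinter> w))"
proof -
  note [simp] = meet_assoc
  have inner: "a \<sqinter> (b \<sqinter> (c \<sqinter> a)) = a \<sqinter> (c \<sqinter> (b \<sqinter> a))"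
    if "a \<in> carrier S" "b \<in> carrier S" "c \<in> carrier S" for a b c
    using meet_normal_aux[of a b c] meet_normal_aux[of a c b]
      commute_below[of a "a \<sqinter> (b \<sqinter> a)" "a \<sqinter> (c \<sqinter> a)"] that by simp
  have swap: "a \<sqinter> (b \<sqinter> (c \<sqinter> (d \<sqinter> a))) = a \<sqinter> (c \<sqinter> (b \<sqinter> (d \<sqinter> a)))"
    if "a \<in> carrier S" "b \<in> carrier S" "c \<in> carrier S" "d \<in> carrier S" for a b c d
  proof -
    have "a \<sqinter> (b \<sqinter> (c \<sqinter> (d \<sqinter> a))) = a \<sqinter> (b \<sqinter> (c \<sqinter> a)) \<sqinter> (d \<sqinter> a)"
      using meet_normal_aux[of a "b \<sqinter> c" d] that by simp
    also have "\<dots> = a \<sqinter> (c \<sqinter> (b \<sqinter> a)) \<sqinter> (d \<sqinter> a)"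
      using inner that by simp
    also have "\<dots> = a \<sqinter> (c \<sqinter> (b \<sqinter> (d \<sqinter> a)))"
      using meet_normal_aux[of a "c \<sqinter> b" d] that by simp
    finally show ?thesis .
  qed
  have "x \<sqinter> (y \<sqinter> (z \<sqinter> w)) = x \<sqinter> (y \<sqinter> (z \<sqinter> (w \<sqinter> (x \<sqinter> (y \<sqinter> (z \<sqinter> w))))))"
    using meet_idem[of "x \<sqinter> (y \<sqinter> (z \<sqinter> w))"] assms by (simp del: meet_idem)
  also have "\<dots> = x \<sqinter> (y \<sqinter> (z \<sqinter> (w \<sqinter> (x \<sqinter> (z \<sqinter> (y \<sqinter> w))))))"
  proof -
    have "w \<sqinter> (x \<sqinter> (y \<sqinter> (z \<sqinter> w))) = w \<sqinter> (x \<sqinter> (z \<sqinter> (y \<sqinter> w)))"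
      using inner[of w x "y \<sqinter> z"] swap[of w y z x] inner[of w "z \<sqinter> y" x] assms by simp
    then show ?thesis by simp
  qed
  also have "\<dots> = x \<sqinter> (y \<sqinter> (z \<sqinter> (w \<sqinter> x))) \<sqinter> (z \<sqinter> (y \<sqinter> w))" using assms by simp
  also have "\<dots> = x \<sqinter> (z \<sqinter> (y \<sqinter> (w \<sqinter> x))) \<sqinter> (z \<sqinter> (y \<sqinter> w))"
    using swap assms by simp
  also have "\<dots> = x \<sqinter> (z \<sqinter> (y \<sqinter> w))"
    using meet_idem[of "x \<sqinter> (z \<sqinter> (y \<sqinter> w))"] assms by (simp del: meet_idem)
  finally show ?thesis .
qed

text \<open>
  The natural preorder; \<open>x\<close> and \<open>y\<close> are \<open>\<D>\<close>-related iff \<open>x \<preceq> y\<close> and \<open>y \<preceq> x\<close>.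
\<close>

abbreviation below (infix "\<preceq>" 50) where "x \<preceq> y \<equiv> x \<sqinter> y \<sqinter> x = x"

lemma meet_zero_commute:
  assumes "x \<in> carrier S" "y \<in> carrier S" "x \<sqinter> y = \<zero>"
  shows "y \<sqinter> x = \<zero>"
proof -
  have "y \<sqinter> x = y \<sqinter> (x \<sqinter> y) \<sqinter> x"
    using meet_idem[of "y \<sqinter> x"] assms(1,2) by (simp add: meet_assoc del: meet_idem)
  then show ?thesis using assms by simp
qed

lemma meet_drop_first:
  assumes "x \<in> carrier S" "y \<in> carrier S" "w \<in> carrier S"
  shows "x \<sqinter> (y \<sqinter> (x \<sqinter> w)) = x \<sqinter> (y \<sqinter> w)"
  by (subst meet_normal) (simp_all add: assms)

lemma meet_drop_last:
  assumes "x \<in> carrier S" "y \<in> carrier S" "w \<in> carrier S"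
  shows "x \<sqinter> (w \<sqinter> (y \<sqinter> w)) = x \<sqinter> (y \<sqinter> w)"
  by (subst meet_normal) (simp_all add: assms)

text \<open>
  Ordered rewriting with these laws sorts the inner letters of a word and removes duplicates, so it
  decides those identities of normal bands that are needed here.
\<close>

lemmas meet_words = meet_assoc meet_normal meet_drop_first meet_drop_last

lemma join_eq_zero:
  assumes "x \<in> carrier S" "y \<in> carrier S" "x \<squnion> y = \<zero>"
  shows "x = \<zero>" "y = \<zero>"
  using meet_absorb1[of x y] meet_absorb2[of y x] assms by auto

text \<open>
  Both joins are equal to \<open>(x \<squnion> y) \<sqinter> (y \<squnion> x)\<close>, expanded by one distributive law or the other.
\<close>

lemma orthogonal_join_commute:
  assumes "x \<in> carrier S" "y \<in> carrier S" "x \<sqinter> y = \<zero>"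
  shows "x \<squnion> y = y \<squnion> x"
proof -
  have yx: "y \<sqinter> x = \<zero>" using assms by (rule meet_zero_commute)
  have "(x \<squnion> y) \<sqinter> (y \<squnion> x) = y \<squnion> x"
    using assms yx by (simp add: distrib_left distrib_right)
  moreover have "(x \<squnion> y) \<sqinter> (y \<squnion> x) = x \<squnion> y"
    using assms yx distrib_right[of x y "y \<squnion> x"]
    by (simp add: distrib_left)
  ultimately show ?thesis by simp
qed

lemma below_trans:
  assumes "x \<in> carrier S" "y \<in> carrier S" "z \<in> carrier S" "x \<preceq> y" "y \<preceq> z"
  shows "x \<preceq> z"
proof -
  have "x = x \<sqinter> (y \<sqinter> z \<sqinter> y) \<sqinter> x" using assms by simp
  also have "\<dots> = x \<sqinter> z \<sqinter> (x \<sqinter> y \<sqinter> x)"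
    using assms(1-3) by (simp add: meet_words)
  finally show ?thesis using assms by simp
qed

text \<open>
  Inside a \<open>\<D>\<close>-class this says that only the first and the last factor of a product matter.
\<close>

lemma meet_drop_below:
  assumes "x \<in> carrier S" "y \<in> carrier S" "w \<in> carrier S" "x \<preceq> y"
  shows "x \<sqinter> (y \<sqinter> w) = x \<sqinter> w"
proof -
  have "x \<sqinter> w = x \<sqinter> y \<sqinter> x \<sqinter> w" using assms by simp
  also have "\<dots> = x \<sqinter> (y \<sqinter> w)" using assms(1-3) by (simp add: meet_assoc meet_drop_first)
  finally show ?thesis by simp
qed

lemma below_meet_zero:
  assumes "x \<in> carrier S" "y \<in> carrier S" "z \<in> carrier S" "x \<preceq> y" "y \<sqinter> z = \<zero>"
  shows "x \<sqinter> z = \<zero>"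
proof -
  have "x \<sqinter> z = x \<sqinter> y \<sqinter> (x \<sqinter> z)" using assms by (simp flip: meet_assoc)
  also have "\<dots> = x \<sqinter> (x \<sqinter> (y \<sqinter> z))"
    using assms(1-3) by (simp add: meet_words)
  finally show ?thesis using assms by simp
qed

lemma below_meet_left: "x \<in> carrier S \<Longrightarrow> y \<in> carrier S \<Longrightarrow> x \<sqinter> y \<preceq> x"
  using meet_idem[of "x \<sqinter> y"] by (simp add: meet_assoc del: meet_idem)

lemma below_meet_right: "x \<in> carrier S \<Longrightarrow> y \<in> carrier S \<Longrightarrow> x \<sqinter> y \<preceq> y"
  using meet_idem[of "x \<sqinter> y"] by (simp add: meet_assoc del: meet_idem)

lemma within_meet:
  assumes "x \<in> carrier S" "y \<in> carrier S" "a \<in> carrier S"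
  shows "(x \<sqinter> y) \<sqinter> a \<sqinter> (x \<sqinter> y) = (x \<sqinter> a \<sqinter> x) \<sqinter> (y \<sqinter> a \<sqinter> y)"
  using assms by (simp add: meet_words)

lemma distrib_both:
  assumes "x \<in> carrier S" "y \<in> carrier S" "z \<in> carrier S" "w \<in> carrier S"
  shows "(x \<squnion> y) \<sqinter> (z \<squnion> w) = (x \<sqinter> z \<squnion> y \<sqinter> z) \<squnion> (x \<sqinter> w \<squnion> y \<sqinter> w)"
  using assms by (simp only: distrib_left distrib_right join_closed)

text \<open>
  Distributivity reduces both sides to the four products of \<open>x \<sqinter> a \<sqinter> x\<close> and \<open>y \<sqinter> a \<sqinter> y\<close>: on the right
  because the join is a meet-idempotent, and normality gives
  \<open>(p \<sqinter> a \<sqinter> p) \<sqinter> (q \<sqinter> a \<sqinter> q) = p \<sqinter> a \<sqinter> q\<close>.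
\<close>

lemma within_join:
  assumes "x \<in> carrier S" "y \<in> carrier S" "a \<in> carrier S"
  shows "(x \<squnion> y) \<sqinter> a \<sqinter> (x \<squnion> y) = (x \<sqinter> a \<sqinter> x) \<squnion> (y \<sqinter> a \<sqinter> y)"
proof -
  let ?u = "x \<sqinter> a \<sqinter> x" and ?v = "y \<sqinter> a \<sqinter> y"
  have prod: "(p \<sqinter> a \<sqinter> p) \<sqinter> (q \<sqinter> a \<sqinter> q) = p \<sqinter> a \<sqinter> q"
    if "p \<in> carrier S" "q \<in> carrier S" for p q
    using assms that by (simp add: meet_words)
  have "?u \<squnion> ?v = (?u \<squnion> ?v) \<sqinter> (?u \<squnion> ?v)" using assms by simp
  also have "\<dots> = ((x \<sqinter> a) \<sqinter> x \<squnion> (y \<sqinter> a) \<sqinter> x) \<squnion> ((x \<sqinter> a) \<sqinter> y \<squnion> (y \<sqinter> a) \<sqinter> y)"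
    using assms by (simp only: distrib_both prod ops_closed)
  also have "\<dots> = (x \<sqinter> a \<squnion> y \<sqinter> a) \<sqinter> (x \<squnion> y)"
    using assms by (simp only: distrib_both ops_closed)
  also have "\<dots> = (x \<squnion> y) \<sqinter> a \<sqinter> (x \<squnion> y)"
    using assms by (simp only: distrib_right)
  finally show ?thesis by simp
qed

text \<open>
  Uniqueness of the splitting along \<open>a\<close>. Comparing the two decompositions \<open>u \<squnion> z\<close> and
  \<open>u \<squnion> (x \<setminus> a)\<close> of \<open>x\<close>, both complements of \<open>u\<close> are equal to \<open>z \<sqinter> (x \<setminus> a)\<close>. All later
  facts about \<open>\<setminus>\<close> come from here.
\<close>

lemma diff_unique:
  assumes S: "x \<in> carrier S" "u \<in> carrier S" "z \<in> carrier S" "a \<in> carrier S"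
    and u: "u \<preceq> a" and z: "z \<sqinter> a = \<zero>" and x: "u \<squnion> z = x"
  shows "x \<setminus> a = z"
proof -
  let ?d = "x \<setminus> a"
  have az: "a \<sqinter> z = \<zero>" using S z by (blast intro: meet_zero_commute)
  have "x \<sqinter> a \<sqinter> x = u"
    unfolding x[symmetric] using S u z az by (simp add: within_join)
  then have d: "u \<squnion> ?d = x" "u \<sqinter> ?d = \<zero>" "?d \<sqinter> u = \<zero>"
    using S diff_join[of x a] diff_meet1[of x a] diff_meet2[of x a] by auto
  have zu: "z \<sqinter> u = \<zero>"
    using S u az z by (metis below_meet_zero meet_zero_commute)
  have "z = z \<sqinter> x" using S zu unfolding x[symmetric] by (simp add: distrib_left)
  also have "\<dots> = z \<sqinter> u \<squnion> z \<sqinter> ?d"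
    using S by (subst d(1)[symmetric]) (simp add: distrib_left)
  also have "\<dots> = z \<sqinter> ?d" using S zu by simp
  also have "\<dots> = x \<sqinter> ?d"
    using S d(2) distrib_right[of u z ?d] by (simp add: x)
  also have "\<dots> = ?d" using S d(2) distrib_right[of u ?d ?d] d(1) by simp
  finally show ?thesis by simp
qed

lemma diff_absorb:
  assumes "x \<in> carrier S" "a \<in> carrier S"
  shows "x \<sqinter> (x \<setminus> a) = x \<setminus> a" "(x \<setminus> a) \<sqinter> x = x \<setminus> a"
  using diff_join[OF assms] diff_meet1[OF assms] diff_meet2[OF assms] assms
    distrib_right[of "x \<sqinter> a \<sqinter> x" "x \<setminus> a" "x \<setminus> a"]
    distrib_left[of "x \<setminus> a" "x \<sqinter> a \<sqinter> x" "x \<setminus> a"] by simp_all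

lemma diff_meet_zero:
  assumes S: "x \<in> carrier S" "a \<in> carrier S"
  shows "(x \<setminus> a) \<sqinter> a = \<zero>"
proof -
  let ?d = "x \<setminus> a"
  have "?d \<sqinter> (a \<sqinter> x) = ?d \<sqinter> (x \<sqinter> a \<sqinter> x)"
    using S diff_absorb[OF S] by (simp flip: meet_assoc)
  then have "?d \<sqinter> (a \<sqinter> x) = \<zero>" using S diff_meet2[OF S] by simp
  then have "?d \<sqinter> a \<sqinter> (x \<sqinter> a) = \<zero>" using S by (simp flip: meet_assoc)
  moreover have "?d \<sqinter> a \<sqinter> (x \<sqinter> a) = ?d \<sqinter> x \<sqinter> a"
    using S by (simp add: meet_words)
  ultimately show ?thesis using diff_absorb[OF S] by simp
qed

lemma within_below:
  assumes "x \<in> carrier S" "a \<in> carrier S"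
  shows "x \<sqinter> a \<sqinter> x \<preceq> a"
proof -
  have "x \<sqinter> a \<sqinter> x \<preceq> x \<sqinter> a" using assms below_meet_left[of "x \<sqinter> a" x] by simp
  then show ?thesis
    using assms below_meet_right[of x a] below_trans[of "x \<sqinter> a \<sqinter> x" "x \<sqinter> a" a] by blast
qed

lemma cross_zero:
  assumes "u \<in> carrier S" "z \<in> carrier S" "a \<in> carrier S" "u \<preceq> a" "z \<sqinter> a = \<zero>"
  shows "u \<sqinter> z = \<zero>" "z \<sqinter> u = \<zero>"
  using assms by (metis below_meet_zero meet_zero_commute)+

text \<open>
  Split \<open>x\<close> and \<open>y\<close> along \<open>a\<close> and multiply out: the mixed products vanish, so the product of the parts
  orthogonal to \<open>a\<close> is the part of \<open>x \<sqinter> y\<close> orthogonal to \<open>a\<close>.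
\<close>

lemma diff_meet_distrib:
  assumes S: "x \<in> carrier S" "y \<in> carrier S" "a \<in> carrier S"
  shows "(x \<sqinter> y) \<setminus> a = (x \<setminus> a) \<sqinter> (y \<setminus> a)"
proof -
  let ?x = "x \<sqinter> a \<sqinter> x" and ?y = "y \<sqinter> a \<sqinter> y"
  have z: "(x \<setminus> a) \<sqinter> a = \<zero>" "(y \<setminus> a) \<sqinter> a = \<zero>"
    and b: "?x \<preceq> a" "?y \<preceq> a"
    using S by (auto intro: diff_meet_zero within_below)
  have c: "?x \<sqinter> (y \<setminus> a) = \<zero>" "(x \<setminus> a) \<sqinter> ?y = \<zero>"
    using cross_zero[of ?x "y \<setminus> a" a] cross_zero[of ?y "x \<setminus> a" a] S z b by auto
  have "x \<sqinter> y = (?x \<squnion> (x \<setminus> a)) \<sqinter> (?y \<squnion> (y \<setminus> a))" using S by (simp only: diff_join)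
  also have "\<dots> = ?x \<sqinter> ?y \<squnion> (x \<setminus> a) \<sqinter> (y \<setminus> a)"
    using S c distrib_left[of ?x ?y "y \<setminus> a"] distrib_left[of "x \<setminus> a" ?y "y \<setminus> a"]
      distrib_right[of ?x "x \<setminus> a" "?y \<squnion> (y \<setminus> a)"]
    by simp
  finally have eq: "?x \<sqinter> ?y \<squnion> (x \<setminus> a) \<sqinter> (y \<setminus> a) = x \<sqinter> y" by simp
  have "?x \<sqinter> ?y \<preceq> a"
    using S b below_meet_left[of ?x ?y] below_trans[of "?x \<sqinter> ?y" ?x a] by blast
  moreover have "(x \<setminus> a) \<sqinter> (y \<setminus> a) \<sqinter> a = \<zero>" using S z by (simp add: meet_assoc)
  ultimately show ?thesis using S eq by (intro diff_unique[of _ "?x \<sqinter> ?y"]) auto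
qed

text \<open>
  As for meets; the parts can be regrouped because orthogonal elements commute under the join.
\<close>

lemma diff_join_distrib:
  assumes S: "x \<in> carrier S" "y \<in> carrier S" "a \<in> carrier S"
  shows "(x \<squnion> y) \<setminus> a = (x \<setminus> a) \<squnion> (y \<setminus> a)"
proof -
  let ?x = "x \<sqinter> a \<sqinter> x" and ?y = "y \<sqinter> a \<sqinter> y"
  have z: "(x \<setminus> a) \<sqinter> a = \<zero>" "(y \<setminus> a) \<sqinter> a = \<zero>"
    and b: "?x \<preceq> a" "?y \<preceq> a"
    using S by (auto intro: diff_meet_zero within_below)
  have c: "(x \<setminus> a) \<squnion> ?y = ?y \<squnion> (x \<setminus> a)"
    using cross_zero[of ?y "x \<setminus> a" a] S z b by (intro orthogonal_join_commute) auto
  have "x \<squnion> y = (?x \<squnion> (x \<setminus> a)) \<squnion> (?y \<squnion> (y \<setminus> a))" using S by (simp only: diff_join)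
  also have "\<dots> = ?x \<squnion> ((x \<setminus> a) \<squnion> ?y) \<squnion> (y \<setminus> a)"
    using S by (simp only: join_assoc ops_closed)
  also have "\<dots> = (?x \<squnion> ?y) \<squnion> ((x \<setminus> a) \<squnion> (y \<setminus> a))"
    unfolding c using S by (simp only: join_assoc ops_closed)
  finally have eq: "(?x \<squnion> ?y) \<squnion> ((x \<setminus> a) \<squnion> (y \<setminus> a)) = x \<squnion> y" by simp
  have "?x \<squnion> ?y \<preceq> a" using S b by (subst within_join) auto
  moreover have "((x \<setminus> a) \<squnion> (y \<setminus> a)) \<sqinter> a = \<zero>" using S z by (simp add: distrib_right)
  ultimately show ?thesis using S eq by (intro diff_unique[of _ "?x \<squnion> ?y"]) auto
qed

lemma diff_of_orthogonal:
  assumes "x \<in> carrier S" "a \<in> carrier S" "x \<sqinter> a = \<zero>"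
  shows "x \<setminus> a = x"
  using assms by (intro diff_unique[of _ \<zero>]) auto

lemma diff_of_below:
  assumes "x \<in> carrier S" "a \<in> carrier S" "x \<preceq> a"
  shows "x \<setminus> a = \<zero>"
  using assms by (intro diff_unique[of _ x]) auto

text \<open>
  On a \<open>\<D>\<close>-class the join is the reversed meet: squaring gives
  \<open>x \<squnion> y = x \<squnion> (y \<sqinter> x) \<squnion> (x \<sqinter> y) \<squnion> y\<close>, in which \<open>y \<sqinter> x\<close> absorbs all other terms.
\<close>

lemma join_D_related:
  assumes S: "x \<in> carrier S" "y \<in> carrier S" and D: "x \<preceq> y" "y \<preceq> x"
  shows "x \<squnion> y = y \<sqinter> x"
proof -
  have "x \<squnion> y = (x \<squnion> y) \<sqinter> (x \<squnion> y)" using S by simp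
  also have "\<dots> = (x \<squnion> y \<sqinter> x) \<squnion> (x \<sqinter> y \<squnion> y)"
    using S by (subst distrib_both) simp_all
  also have "\<dots> = (x \<squnion> y \<sqinter> x) \<squnion> y" using S by (simp add: join_absorb2)
  also have "x \<squnion> y \<sqinter> x = y \<sqinter> x"
    using S D by (simp add: join_eq_right_iff flip: meet_assoc)
  also have "y \<sqinter> x \<squnion> y = y \<sqinter> x"
    using S D by (simp add: join_eq_left_iff)
  finally show ?thesis .
qed

end

section \<open>Homomorphisms\<close>

lemma sba_homD:
  assumes "h \<in> sba_hom S T"
  shows "x \<in> carrier S \<Longrightarrow> h x \<in> carrier T"
    and "x \<in> carrier S \<Longrightarrow> y \<in> carrier S \<Longrightarrow> h (x \<sqinter>\<^bsub>S\<^esub> y) = h x \<sqinter>\<^bsub>T\<^esub> h y"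
    and "x \<in> carrier S \<Longrightarrow> y \<in> carrier S \<Longrightarrow> h (x \<squnion>\<^bsub>S\<^esub> y) = h x \<squnion>\<^bsub>T\<^esub> h y"
    and "x \<in> carrier S \<Longrightarrow> y \<in> carrier S \<Longrightarrow> h (x \<setminus>\<^bsub>S\<^esub> y) = h x \<setminus>\<^bsub>T\<^esub> h y"
    and "h \<zero>\<^bsub>S\<^esub> = \<zero>\<^bsub>T\<^esub>"
  using assms by (auto simp: sba_hom_def)

text \<open>
  The difference is determined by meet, join and zero through \<open>diff_unique\<close>, so it is preserved
  automatically.
\<close>

lemma lattice_hom_imp_sba_hom:
  assumes "skew_boolean_algebra S" "skew_boolean_algebra T"
    and h: "\<And>x. x \<in> carrier S \<Longrightarrow> h x \<in> carrier T"
    and m: "\<And>x y. x \<in> carrier S \<Longrightarrow> y \<in> carrier S \<Longrightarrow> h (x \<sqinter>\<^bsub>S\<^esub> y) = h x \<sqinter>\<^bsub>T\<^esub> h y"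
    and j: "\<And>x y. x \<in> carrier S \<Longrightarrow> y \<in> carrier S \<Longrightarrow> h (x \<squnion>\<^bsub>S\<^esub> y) = h x \<squnion>\<^bsub>T\<^esub> h y"
    and z: "h \<zero>\<^bsub>S\<^esub> = \<zero>\<^bsub>T\<^esub>"
  shows "h \<in> sba_hom S T"
proof -
  interpret S: skew_boolean_algebra S by fact
  interpret T: skew_boolean_algebra T by fact
  have "h (x \<setminus>\<^bsub>S\<^esub> y) = h x \<setminus>\<^bsub>T\<^esub> h y" if "x \<in> carrier S" "y \<in> carrier S" for x y
  proof -
    let ?u = "x \<sqinter>\<^bsub>S\<^esub> y \<sqinter>\<^bsub>S\<^esub> x"
    have "h ?u \<squnion>\<^bsub>T\<^esub> h (x \<setminus>\<^bsub>S\<^esub> y) = h x"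
      using that by (simp add: S.diff_join flip: j)
    moreover have "h (x \<setminus>\<^bsub>S\<^esub> y) \<sqinter>\<^bsub>T\<^esub> h y = \<zero>\<^bsub>T\<^esub>"
      using that by (simp add: S.diff_meet_zero z flip: m)
    moreover have "h ?u \<sqinter>\<^bsub>T\<^esub> h y \<sqinter>\<^bsub>T\<^esub> h ?u = h (?u \<sqinter>\<^bsub>S\<^esub> y \<sqinter>\<^bsub>S\<^esub> ?u)"
      using that by (simp only: m S.ops_closed)
    then have "h ?u \<sqinter>\<^bsub>T\<^esub> h y \<sqinter>\<^bsub>T\<^esub> h ?u = h ?u"
      using that S.within_below by simp
    ultimately show ?thesis
      using that h by (intro sym[OF T.diff_unique[of _ "h ?u"]]) auto
  qed
  then show ?thesis using h m j z by (auto simp: sba_hom_def)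
qed

lemma sba_hom_comp: "h \<in> sba_hom S T \<Longrightarrow> k \<in> sba_hom T U \<Longrightarrow> (\<lambda>x. k (h x)) \<in> sba_hom S U"
  by (auto simp: sba_hom_def Pi_iff)

context skew_boolean_algebra
begin

lemma within_hom: "a \<in> carrier S \<Longrightarrow> (\<lambda>x. x \<sqinter> a \<sqinter> x) \<in> sba_hom S S"
  by (intro lattice_hom_imp_sba_hom)
    (auto simp: within_meet within_join intro: skew_boolean_algebra_axioms)

lemma diff_hom: "a \<in> carrier S \<Longrightarrow> (\<lambda>x. x \<setminus> a) \<in> sba_hom S S"
  by (intro lattice_hom_imp_sba_hom)
    (auto simp: diff_meet_distrib diff_join_distrib diff_of_orthogonal
      intro: skew_boolean_algebra_axioms)

end

text \<open>
  Subalgebras of the form \<open>with_zero\<close> are recognised as skew Boolean algebras by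
  exhibiting them as homomorphic images of the whole algebra.
\<close>

lemma sba_hom_image:
  assumes "skew_boolean_algebra S" and h: "h \<in> sba_hom S T" and im: "h ` carrier S = carrier T"
  shows "skew_boolean_algebra T"
proof -
  interpret skew_boolean_algebra S by fact
  note [simp] = sba_homD(2-5)[OF h, symmetric]
  show ?thesis
    unfolding skew_boolean_algebra_def skew_boolean_algebra_axioms_def skew_lattice_def
      im[symmetric] all_image
    by (simp add: meet_absorb1 meet_absorb2 join_absorb1 join_absorb2 distrib_left distrib_right
          diff_join diff_meet1 diff_meet2 cong: ball_cong)
      (simp add: meet_assoc join_assoc)
qed

lemma sba_iso_inverse:
  assumes S: "closed_algebra S" and h: "h \<in> sba_iso S T" and k: "\<And>x. x \<in> carrier S \<Longrightarrow> k (h x) = x"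
  shows "k \<in> sba_iso T S"
proof -
  interpret closed_algebra S by fact
  have hom: "h \<in> sba_hom S T" and im: "h ` carrier S = carrier T"
    using h by (auto simp: sba_iso_def bij_betw_def)
  have "\<forall>x\<in>carrier S. k (h x) = x" using k by blast
  moreover from this have "bij_betw k (carrier T) (carrier S)"
    unfolding im[symmetric] by (intro bij_betw_byWitness[of _ h]) auto
  moreover have "k \<zero>\<^bsub>T\<^esub> = \<zero>\<^bsub>S\<^esub>"
    using k closed(4) sba_homD(5)[OF hom] by metis
  ultimately show ?thesis
    unfolding sba_iso_def sba_hom_def im[symmetric]
    by (auto simp: closed k simp flip: sba_homD(2-5)[OF hom])
qed

lemma sba_isomorphic_sym:
  assumes "closed_algebra S" "S \<simeq> T"
  shows "T \<simeq> S"
proof -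
  from assms(2) obtain h where h: "h \<in> sba_iso S T" by (auto simp: sba_isomorphic_def)
  then have "inj_on h (carrier S)" by (simp add: sba_iso_def bij_betw_def)
  then have "inv_into (carrier S) h \<in> sba_iso T S"
    using assms(1) h by (intro sba_iso_inverse[of S h]) simp_all
  then show ?thesis by (auto simp: sba_isomorphic_def)
qed

lemma sba_isomorphic_trans:
  assumes "S \<simeq> T" "T \<simeq> U"
  shows "S \<simeq> U"
proof -
  from assms obtain h k where "h \<in> sba_iso S T" "k \<in> sba_iso T U"
    by (auto simp: sba_isomorphic_def)
  then have "(\<lambda>x. k (h x)) \<in> sba_iso S U"
    using sba_hom_comp[of h S T k U] bij_betw_trans[of h "carrier S" "carrier T" k "carrier U"]
    by (simp add: sba_iso_def comp_def)
  then show ?thesis by (auto simp: sba_isomorphic_def)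
qed

lemma (in skew_boolean_algebra) joins_closed: "set xs \<subseteq> carrier S \<Longrightarrow> joins S xs \<in> carrier S"
  by (induction xs) auto

lemma (in skew_boolean_algebra) hom_joins:
  "h \<in> sba_hom S T \<Longrightarrow> set xs \<subseteq> carrier S \<Longrightarrow> h (joins S xs) = joins T (map h xs)"
  by (induction xs) (auto simp: sba_homD joins_closed)

text \<open>
  The statement is about an arbitrary enumeration because an orthosum is a join over a list in any
  order.
\<close>

lemma (in skew_boolean_algebra) joins_single:
  assumes "distinct ps" "q \<in> set ps" "f q \<in> carrier S"
    and "\<And>p. p \<in> set ps \<Longrightarrow> p \<noteq> q \<Longrightarrow> f p = \<zero>"
  shows "joins S (map f ps) = f q"
proof -
  have zero: "joins S (map f rs) = \<zero>" if "\<And>p. p \<in> set rs \<Longrightarrow> f p = \<zero>" for rs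
    using that by (induction rs) auto
  show ?thesis
    using assms
  proof (induction ps)
    case (Cons p ps)
    show ?case
    proof (cases "p = q")
      case True
      then have "joins S (map f ps) = \<zero>" using Cons.prems by (intro zero) auto
      then show ?thesis using True Cons.prems by simp
    next
      case False
      then show ?thesis using Cons by auto
    qed
  qed simp
qed

lemma sba_isomorphicI:
  assumes "h \<in> sba_hom S T" "\<And>y. y \<in> carrier T \<Longrightarrow> k y \<in> carrier S"
    "\<And>x. x \<in> carrier S \<Longrightarrow> k (h x) = x" "\<And>y. y \<in> carrier T \<Longrightarrow> h (k y) = y"
  shows "S \<simeq> T"
proof -
  have "bij_betw h (carrier S) (carrier T)"
    using assms sba_homD(1)[OF assms(1)] by (intro bij_betw_byWitness[of _ k]) auto
  then show ?thesis using assms(1) by (auto simp: sba_isomorphic_def sba_iso_def)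
qed

lemma sba_isomorphicD:
  assumes "S \<simeq> T"
  shows "\<exists>h k. h \<in> sba_hom S T \<and> (\<forall>y\<in>carrier T. k y \<in> carrier S) \<and>
    (\<forall>x\<in>carrier S. k (h x) = x) \<and> (\<forall>y\<in>carrier T. h (k y) = y)"
proof -
  from assms obtain h where h: "h \<in> sba_hom S T" "bij_betw h (carrier S) (carrier T)"
    by (auto simp: sba_isomorphic_def sba_iso_def)
  then show ?thesis
    using bij_betw_inv_into_left[OF h(2)] bij_betw_inv_into_right[OF h(2)]
      bij_betw_apply[OF bij_betw_inv_into[OF h(2)]]
    by (intro exI[of _ h] exI[of _ "inv_into (carrier S) h"]) auto
qed

lemma sba_isomorphic_refl: "S \<simeq> S"
  by (rule sba_isomorphicI[of id _ _ id]) (auto simp: sba_hom_def)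

section \<open>Cells\<close>

text \<open>
  The endomorphism that projects onto the cell of the Venn diagram of the generators \<open>g u\<close> that lies
  inside \<open>g u\<close> for \<open>u \<in> L\<close> and outside \<open>g u\<close> for \<open>u \<notin> L\<close>. The set \<open>L\<close> may contain elements that are
  not listed in \<open>us\<close>; this is convenient for induction over \<open>us\<close>.
\<close>

primrec cell_map :: "('a, 'm) sba_scheme \<Rightarrow> ('v \<Rightarrow> 'a) \<Rightarrow> 'v set \<Rightarrow> 'v list \<Rightarrow> 'a \<Rightarrow> 'a" where
  "cell_map S g L [] x = x"
| "cell_map S g L (u # us) x =
    (let w = cell_map S g L us x in if u \<in> L then w \<sqinter>\<^bsub>S\<^esub> g u \<sqinter>\<^bsub>S\<^esub> w else w \<setminus>\<^bsub>S\<^esub> g u)"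

lemma cell_map_cong:
  "(\<And>u. u \<in> set us \<Longrightarrow> u \<in> L \<longleftrightarrow> u \<in> M) \<Longrightarrow> cell_map S g L us x = cell_map S g M us x"
  by (induction us) (auto simp: Let_def)

context skew_boolean_algebra
begin

lemma cell_map_hom:
  assumes "g \<in> set us \<rightarrow> carrier S"
  shows "cell_map S g L us \<in> sba_hom S S"
  using assms
proof (induction us)
  case Nil
  then show ?case by (auto simp: sba_hom_def)
next
  case (Cons u us)
  then have "cell_map S g L us \<in> sba_hom S S" "g u \<in> carrier S" by auto
  then have "(\<lambda>x. cell_map S g L us x \<sqinter> g u \<sqinter> cell_map S g L us x) \<in> sba_hom S S"
    "(\<lambda>x. cell_map S g L us x \<setminus> g u) \<in> sba_hom S S"
    using sba_hom_comp within_hom diff_hom by blast+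
  then show ?case by (cases "u \<in> L") (simp_all add: Let_def[abs_def] eta_contract_eq)
qed

lemmas cell_map_simps = sba_homD[OF cell_map_hom]

lemma cell_map_in_cell:
  assumes "g \<in> set us \<rightarrow> carrier S" "x \<in> carrier S" "u \<in> set us"
  shows "u \<in> L \<Longrightarrow> cell_map S g L us x \<preceq> g u"
    and "u \<notin> L \<Longrightarrow> cell_map S g L us x \<sqinter> g u = \<zero>"
proof -
  have "if u \<in> L then cell_map S g L us x \<preceq> g u else cell_map S g L us x \<sqinter> g u = \<zero>"
    using assms
  proof (induction us)
    case (Cons v us)
    let ?w = "cell_map S g L us x" and ?w' = "cell_map S g L (v # us) x"
    have w: "?w \<in> carrier S" "g v \<in> carrier S" "g u \<in> carrier S"
      using Cons.prems cell_map_simps(1)[of g us x L] by auto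
    have w'_w: "?w' \<in> carrier S" "?w' \<preceq> ?w"
      using w diff_absorb[of ?w "g v"] below_meet_left[of ?w "g v \<sqinter> ?w"]
      by (auto simp: Let_def meet_assoc)
    show ?case
    proof (cases "u = v")
      case True
      then show ?thesis
        using w within_below[of ?w "g v"] diff_meet_zero[of ?w "g v"] by (simp add: Let_def)
    next
      case False
      then have "if u \<in> L then ?w \<preceq> g u else ?w \<sqinter> g u = \<zero>" using Cons by auto
      then show ?thesis
        using w w'_w below_trans[of ?w' ?w "g u"] below_meet_zero[of ?w' ?w "g u"]
        by (simp split: if_splits del: cell_map.simps)
    qed
  qed simp
  then show "u \<in> L \<Longrightarrow> cell_map S g L us x \<preceq> g u"
    and "u \<notin> L \<Longrightarrow> cell_map S g L us x \<sqinter> g u = \<zero>" by simp_all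
qed

lemma cell_map_fixes:
  assumes "g \<in> set us \<rightarrow> carrier S" "x \<in> carrier S"
    and "\<And>u. u \<in> set us \<Longrightarrow> u \<in> L \<Longrightarrow> x \<preceq> g u"
    and "\<And>u. u \<in> set us \<Longrightarrow> u \<notin> L \<Longrightarrow> x \<sqinter> g u = \<zero>"
  shows "cell_map S g L us x = x"
  using assms by (induction us) (auto simp: Let_def diff_of_orthogonal)

text \<open>
  Each splitting step loses nothing, since \<open>w\<close> is recovered as \<open>(w \<sqinter> g v \<sqinter> w) \<squnion> (w \<setminus> g v)\<close>.
\<close>

lemma cell_maps_jointly_inj:
  assumes "g \<in> set us \<rightarrow> carrier S" "distinct us" "x \<in> carrier S" "y \<in> carrier S"
    and "\<And>L. L \<subseteq> set us \<Longrightarrow> cell_map S g L us x = cell_map S g L us y"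
  shows "x = y"
  using assms
proof (induction us)
  case (Cons v us)
  have "cell_map S g L us x = cell_map S g L us y" if L: "L \<subseteq> set us" for L
  proof -
    let ?x = "cell_map S g L us x" and ?y = "cell_map S g L us y"
    have c: "?x \<in> carrier S" "?y \<in> carrier S" "g v \<in> carrier S"
      using Cons.prems cell_map_simps(1)[of g us _ L] by auto
    have v: "v \<notin> L" using L Cons.prems by auto
    have ins: "cell_map S g (insert v L) us z = cell_map S g L us z" for z
      using Cons.prems by (intro cell_map_cong) auto
    have "?x \<sqinter> g v \<sqinter> ?x = ?y \<sqinter> g v \<sqinter> ?y"
      using Cons.prems(5)[of "insert v L"] L by (auto simp: ins Let_def)
    moreover have "?x \<setminus> g v = ?y \<setminus> g v"
      using Cons.prems(5)[of L] L v by (auto simp: Let_def)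
    ultimately show ?thesis using diff_join c by metis
  qed
  then show ?case using Cons by auto
qed simp

end

lemma hom_cell_map:
  assumes "skew_boolean_algebra S" "h \<in> sba_hom S Q" "g \<in> set us \<rightarrow> carrier S" "x \<in> carrier S"
  shows "h (cell_map S g L us x) = cell_map Q (\<lambda>u. h (g u)) L us (h x)"
proof -
  interpret skew_boolean_algebra S by fact
  show ?thesis
    using assms(3-)
  proof (induction us)
    case (Cons u us)
    then have "cell_map S g L us x \<in> carrier S" "g u \<in> carrier S"
      using cell_map_simps(1)[of g us x L] by auto
    then show ?case using Cons by (auto simp: Let_def sba_homD[OF assms(2)])
  qed simp
qed

section \<open>Orthosum decomposition of a finitely generated algebra\<close>

text \<open>
  An algebra generated by \<open>g u\<close> for \<open>u\<close> in the list \<open>us\<close>; generation is expressed as an induction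
  rule.
\<close>

locale generated_sba = skew_boolean_algebra S for S :: "'a sba" (structure) +
  fixes g :: "'v \<Rightarrow> 'a" and us :: "'v list"
  assumes distinct_us: "distinct us"
    and gens: "g \<in> set us \<rightarrow> carrier S"
    and generated [consumes 1, case_names gen zero meet join diff]:
      "x \<in> carrier S \<Longrightarrow> (\<And>u. u \<in> set us \<Longrightarrow> P (g u)) \<Longrightarrow> P \<zero> \<Longrightarrow>
       (\<And>x y. x \<in> carrier S \<Longrightarrow> y \<in> carrier S \<Longrightarrow> P x \<Longrightarrow> P y \<Longrightarrow> P (x \<sqinter> y)) \<Longrightarrow>
       (\<And>x y. x \<in> carrier S \<Longrightarrow> y \<in> carrier S \<Longrightarrow> P x \<Longrightarrow> P y \<Longrightarrow> P (x \<squnion> y)) \<Longrightarrow>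
       (\<And>x y. x \<in> carrier S \<Longrightarrow> y \<in> carrier S \<Longrightarrow> P x \<Longrightarrow> P y \<Longrightarrow> P (x \<setminus> y)) \<Longrightarrow> P x"
begin

abbreviation proj where "proj L \<equiv> cell_map S g L us"

text \<open>
  The part of a generator in the cell of \<open>L\<close>. The parts of the generators in \<open>L\<close> are mutually
  \<open>\<D>\<close>-related, so the rectangular band that they generate consists of the products of two of them.
\<close>

definition part :: "'v set \<Rightarrow> 'v \<Rightarrow> 'a" where "part L u = proj L (g u)"

definition component :: "'v set \<Rightarrow> 'a set" where
  "component L = {part L u \<sqinter> part L v |u v. u \<in> L \<and> v \<in> L}"

lemmas proj_hom = cell_map_hom[OF gens]
lemmas proj_simps [simp] = cell_map_simps[OF gens]
lemmas proj_in_cell = cell_map_in_cell[OF gens]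

lemma gen_closed [simp]: "u \<in> set us \<Longrightarrow> g u \<in> carrier S"
  using gens by auto

lemma proj_idem [simp]: "x \<in> carrier S \<Longrightarrow> proj L (proj L x) = proj L x"
  by (intro cell_map_fixes gens proj_in_cell) auto

text \<open>
  The projection of \<open>g u\<close> is orthogonal to \<open>g u\<close>. Projecting this once more shows that it is orthogonal to
  itself.
\<close>

lemma proj_gen_outside:
  assumes "u \<in> set us" "u \<notin> L"
  shows "proj L (g u) = \<zero>"
proof -
  let ?z = "proj L (g u)"
  have "?z = proj L (?z \<sqinter> g u)" using assms by simp
  then show ?thesis using assms proj_in_cell(2)[of "g u" u L] by simp
qed

text \<open>
  A generator in exactly one of \<open>L\<close> and \<open>M\<close> separates the two cells.
\<close>

lemma proj_orthogonal:
  assumes "x \<in> carrier S" "y \<in> carrier S" "L \<subseteq> set us" "M \<subseteq> set us" "L \<noteq> M"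
  shows "proj L x \<sqinter> proj M y = \<zero>"
proof -
  consider u where "u \<in> L" "u \<notin> M" | u where "u \<in> M" "u \<notin> L" using assms by blast
  then show ?thesis
  proof cases
    case (1 u)
    then show ?thesis
      using cross_zero(1)[of "proj L x" "proj M y" "g u"] proj_in_cell(1)[of x u L]
        proj_in_cell(2)[of y u M] assms by auto
  next
    case (2 u)
    then show ?thesis
      using cross_zero(2)[of "proj M y" "proj L x" "g u"] proj_in_cell(1)[of y u M]
        proj_in_cell(2)[of x u L] assms by auto
  qed
qed

lemma proj_proj_other:
  assumes "x \<in> carrier S" "L \<subseteq> set us" "M \<subseteq> set us" "L \<noteq> M"
  shows "proj L (proj M x) = \<zero>"
proof -
  let ?w = "proj L (proj M x)"
  have "?w = proj L (?w \<sqinter> proj M x)" using assms by simp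
  then show ?thesis using assms proj_orthogonal[of "proj M x" x L M] by simp
qed

text \<open>
  Only \<open>0\<close> is orthogonal to all generators; this is why \<open>L = {}\<close> contributes nothing.
\<close>

lemma proj_empty: "x \<in> carrier S \<Longrightarrow> proj {} x = \<zero>"
  by (induction rule: generated) (auto simp: proj_gen_outside diff_of_orthogonal)

lemma part_closed [simp]: "u \<in> L \<Longrightarrow> L \<subseteq> set us \<Longrightarrow> part L u \<in> carrier S"
  by (auto simp: part_def)

lemma proj_part [simp]: "u \<in> L \<Longrightarrow> L \<subseteq> set us \<Longrightarrow> proj L (part L u) = part L u"
  by (auto simp: part_def)

lemma part_below:
  assumes "u \<in> L" "v \<in> L" "L \<subseteq> set us"
  shows "part L u \<preceq> part L v"
proof -
  have uv: "u \<in> set us" "v \<in> set us" using assms by auto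
  then have "part L u \<preceq> g v"
    using assms by (auto simp: part_def intro!: proj_in_cell(1))
  then have "proj L (part L u \<sqinter> g v \<sqinter> part L u) = proj L (part L u)" by simp
  then show ?thesis using assms uv by (simp flip: part_def)
qed

lemma part_meet_part:
  assumes "u \<in> L" "v \<in> L" "u' \<in> L" "v' \<in> L" "L \<subseteq> set us"
  shows "(part L u \<sqinter> part L v) \<sqinter> (part L u' \<sqinter> part L v') = part L u \<sqinter> part L v'"
  using assms by (simp add: meet_assoc meet_drop_below part_below)

lemma component_below:
  assumes "x \<in> component L" "y \<in> component L" "L \<subseteq> set us"
  shows "x \<preceq> y"
  using assms by (auto simp: component_def part_meet_part)

lemma component_closed: "x \<in> component L \<Longrightarrow> L \<subseteq> set us \<Longrightarrow> x \<in> carrier S"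
  by (auto simp: component_def)

lemma proj_component: "x \<in> component L \<Longrightarrow> L \<subseteq> set us \<Longrightarrow> proj L x = x"
  by (auto simp: component_def)

lemma part_in_component: "u \<in> L \<Longrightarrow> L \<subseteq> set us \<Longrightarrow> part L u \<in> component L"
  using meet_idem[of "part L u"] by (force simp: component_def simp del: meet_idem)

text \<open>
  By induction over the generation of \<open>x\<close>: on \<open>component L\<close> meets are products in a rectangular band,
  joins are reversed meets and differences vanish.
\<close>

lemma proj_in_component:
  assumes "x \<in> carrier S" "L \<subseteq> set us"
  shows "proj L x \<in> insert \<zero> (component L)"
  using assms(1)
proof (induction rule: generated)
  case (gen u)
  then show ?case
    using part_in_component[of u L] proj_gen_outside[of u L] assms(2) by (auto simp: part_def)
next
  case (meet x y)
  then show ?case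
    using part_meet_part[OF _ _ _ _ assms(2)] assms(2)
    by (fastforce simp: component_def)
next
  case (join x y)
  have "x' \<squnion> y' \<in> component L" if "x' \<in> component L" "y' \<in> component L" for x' y'
  proof -
    have "x' \<squnion> y' = y' \<sqinter> x'"
      using that assms(2) by (intro join_D_related component_below component_closed)
    then show ?thesis using that part_meet_part[OF _ _ _ _ assms(2)]
      by (fastforce simp: component_def)
  qed
  then show ?case using join component_closed[OF _ assms(2)] by auto
next
  case (diff x y)
  then show ?case
    using assms(2) component_below[of _ L] component_closed[OF _ assms(2)]
    by (auto simp: diff_of_below diff_of_orthogonal)
qed auto

lemma proj_image: "L \<subseteq> set us \<Longrightarrow> proj L ` carrier S = insert \<zero> (component L)"
  using proj_in_component[of _ L] proj_component[of _ L] component_closed[of _ L]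
  by (auto simp: image_iff) (metis zero_closed proj_simps(5), metis)

lemma proj_hom_component:
  "L \<subseteq> set us \<Longrightarrow> proj L \<in> sba_hom S (with_zero S (component L))"
  using proj_in_component[of _ L] by (auto simp: sba_hom_def with_zero_def)

lemma sba_component:
  assumes "L \<subseteq> set us"
  shows "skew_boolean_algebra (with_zero S (component L))"
  using skew_boolean_algebra_axioms proj_hom_component[OF assms]
  by (rule sba_hom_image) (simp add: proj_image[OF assms] with_zero_def)

text \<open>
  An element \<open>\<D>\<close>-related to a member of the component lies below the generators in \<open>L\<close> and is orthogonal
  to the others, hence is fixed by the projection and belongs to the component.
\<close>

lemma component_D_class:
  assumes L: "L \<subseteq> set us" "L \<noteq> {}" and nz: "\<zero> \<notin> component L"
  shows "nonzero_D_class S (component L)"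
proof -
  obtain u where u: "u \<in> L" using L by blast
  define e where "e = part L u"
  have e: "e \<in> component L" "e \<in> carrier S" "e \<noteq> \<zero>"
    using u L nz part_in_component[of u L] unfolding e_def by auto
  have "component L = D_rel S `` {e}"
  proof (intro equalityI subsetI)
    fix x assume "x \<in> component L"
    then show "x \<in> D_rel S `` {e}"
      using e L component_below component_closed by (auto simp: D_rel_def)
  next
    fix x assume "x \<in> D_rel S `` {e}"
    then have x: "x \<in> carrier S" "e \<preceq> x" "x \<preceq> e" by (auto simp: D_rel_def)
    have pe: "proj L e = e" using e L by (intro proj_component)
    have "x \<preceq> g v" if "v \<in> set us" "v \<in> L" for v
      using that e x pe proj_in_cell(1)[of e v L] below_trans[of x e "g v"] by simp
    moreover have "x \<sqinter> g v = \<zero>" if "v \<in> set us" "v \<notin> L" for v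
      using that e x pe proj_in_cell(2)[of e v L] below_meet_zero[of x e "g v"] by simp
    ultimately have "proj L x = x" using x gens by (intro cell_map_fixes)
    moreover have "x \<noteq> \<zero>" using x e by auto
    ultimately show "x \<in> component L" using proj_in_component[of x L] x L by auto
  qed
  then show ?thesis using e nz by (auto simp: nonzero_D_class_def intro!: quotientI)
qed

end

lemma finite_ordered_partitions: "finite X \<Longrightarrow> finite (ordered_partitions X)"
  by (rule finite_subset[of _ "Pow X \<times> Pow X"]) (auto simp: ordered_partitions_def)

lemma ordered_partitions_fst_inj: "inj_on fst (ordered_partitions X)"
  by (auto simp: ordered_partitions_def inj_on_def)

lemma fst_ordered_partitions: "fst ` ordered_partitions X = Pow X - {{}}"
proof (intro equalityI subsetI)
  fix L assume "L \<in> Pow X - {{}}"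
  then have "(L, X - L) \<in> ordered_partitions X" by (auto simp: ordered_partitions_def)
  then show "L \<in> fst ` ordered_partitions X" by (rule image_eqI[rotated]) simp
qed (auto simp: ordered_partitions_def)

context generated_sba
begin

text \<open>
  The map \<open>\<Phi>\<close> sending \<open>x\<close> to the family of its projections is a homomorphism into the product, and it
  is injective by \<open>cell_maps_jointly_inj\<close>. Orthogonality makes \<open>f\<close> the family of projections of the
  join of \<open>f\<close>, in whatever order the join is taken. So \<open>\<Phi>\<close> is an isomorphism and the
  join its inverse.
\<close>

lemma direct_sum_components:
  assumes nz: "\<And>L. L \<subseteq> set us \<Longrightarrow> L \<noteq> {} \<Longrightarrow> \<zero> \<notin> component L"
  defines "I \<equiv> ordered_partitions (set us)"
  shows "is_direct_sum S I (\<lambda>p. component (fst p))" (is ?sum)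
    and "S \<simeq> sba_prod I (\<lambda>p. with_zero S (component (fst p)))" (is "S \<simeq> ?P")
proof -
  have I: "fst p \<subseteq> set us" "fst p \<noteq> {}" if "p \<in> I" for p
    using that by (auto simp: I_def ordered_partitions_def)
  have fst_eq: "fst p = fst q \<longleftrightarrow> p = q" if "p \<in> I" "q \<in> I" for p q
    using that ordered_partitions_fst_inj[of "set us"] by (auto simp: I_def inj_on_def)
  define \<Phi> where "\<Phi> x = (\<lambda>p\<in>I. proj (fst p) x)" for x
  have hom: "\<Phi> \<in> sba_hom S ?P"
    using proj_in_component I
    by (auto simp: sba_hom_def sba_prod_def with_zero_def \<Phi>_def restrict_def fun_eq_iff PiE_iff
        extensional_def)
  have inj: "x = y" if "x \<in> carrier S" "y \<in> carrier S" "\<Phi> x = \<Phi> y" for x y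
  proof (rule cell_maps_jointly_inj[OF gens distinct_us that(1,2)])
    fix L assume L: "L \<subseteq> set us"
    show "proj L x = proj L y"
    proof (cases "L = {}")
      \<comment> \<open>The index set \<open>I\<close> omits the empty \<open>L\<close>, whose projection is zero.\<close>
      case True
      then show ?thesis using that by (simp add: proj_empty)
    next
      case False
      then obtain p where "p \<in> I" "fst p = L"
        using L fst_ordered_partitions[of "set us"] unfolding I_def
        by (metis Diff_iff PowI imageE singletonD)
      then show ?thesis using fun_cong[OF that(3), of p] by (simp add: \<Phi>_def)
    qed
  qed
  have comps: "f p \<in> carrier S" "proj (fst p) (f p) = f p"
    "\<And>q. q \<in> I \<Longrightarrow> q \<noteq> p \<Longrightarrow> proj (fst q) (f p) = \<zero>"
    if "f \<in> carrier ?P" "p \<in> I" for f p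
  proof -
    have "f p \<in> insert \<zero> (component (fst p))"
      using that by (auto simp: sba_prod_def with_zero_def)
    then show f: "f p \<in> carrier S" "proj (fst p) (f p) = f p"
      using I[OF that(2)] component_closed proj_component by auto
    show "proj (fst q) (f p) = \<zero>" if "q \<in> I" "q \<noteq> p" for q
      using proj_proj_other[of "f p" "fst q" "fst p"] f I that \<open>p \<in> I\<close> fst_eq by simp
  qed
  have joins: "joins S (map f ps) \<in> carrier S" "\<Phi> (joins S (map f ps)) = f"
    if ps: "distinct ps" "set ps = I" and f: "f \<in> carrier ?P" for f ps
  proof -
    have sub: "set (map f ps) \<subseteq> carrier S" using comps(1)[OF f] ps by auto
    then show "joins S (map f ps) \<in> carrier S" by (rule joins_closed)
    have "proj (fst q) (joins S (map f ps)) = f q" if q: "q \<in> I" for q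
      using hom_joins[OF proj_hom sub, of "fst q"] comps[OF f] ps q
        joins_single[of ps q "\<lambda>p. proj (fst q) (f p)"]
      by (simp add: comp_def)
    then show "\<Phi> (joins S (map f ps)) = f"
      using f by (auto simp: \<Phi>_def sba_prod_def fun_eq_iff PiE_iff extensional_def)
  qed
  have recombine: "joins S (map (\<Phi> x) ps) = x"
    if ps: "distinct ps" "set ps = I" and x: "x \<in> carrier S" for x ps
    using inj[OF joins(1)[OF ps] x] joins(2)[OF ps] sba_homD(1)[OF hom x] by blast
  have fin: "finite I" unfolding I_def by (intro finite_ordered_partitions) simp
  then obtain ps where ps: "distinct ps" "set ps = I" using finite_distinct_list by blast
  have iso: "\<Phi> \<in> sba_iso S ?P"
    unfolding sba_iso_def bij_betw_def
  proof (intro CollectI conjI equalityI subsetI hom)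
    show "inj_on \<Phi> (carrier S)" using inj by (rule inj_onI)
    show "f \<in> \<Phi> ` carrier S" if "f \<in> carrier ?P" for f
      using joins[OF ps that] by (intro image_eqI[of _ _ "joins S (map f ps)"]) simp_all
  qed (use sba_homD(1)[OF hom] in auto)
  then show "S \<simeq> ?P" by (auto simp: sba_isomorphic_def)
  have closed: "closed_algebra S" by unfold_locales auto
  have "carrier S = orthosum S (map (\<lambda>p. component (fst p)) ps)"
    if ps: "distinct ps" "set ps = I" for ps
  proof (intro equalityI subsetI)
    fix x assume x: "x \<in> carrier S"
    then have "list_all2 (\<lambda>x D. x \<in> carrier (with_zero S D)) (map (\<Phi> x) ps)
        (map (\<lambda>p. component (fst p)) ps)"
      using sba_homD(1)[OF hom x] ps
      by (auto simp: list_all2_conv_all_nth sba_prod_def)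
    then show "x \<in> orthosum S (map (\<lambda>p. component (fst p)) ps)"
      using recombine[OF ps x] by (force simp: orthosum_def)
  next
    fix x assume "x \<in> orthosum S (map (\<lambda>p. component (fst p)) ps)"
    then obtain xs where xs: "x = joins S xs"
      "list_all2 (\<lambda>x D. x \<in> carrier (with_zero S D)) xs (map (\<lambda>p. component (fst p)) ps)"
      by (auto simp: orthosum_def)
    have "set xs \<subseteq> carrier S"
    proof
      fix y assume "y \<in> set xs"
      then obtain i where "i < length ps" "y \<in> insert \<zero> (component (fst (ps ! i)))"
        using xs(2) by (auto simp: list_all2_conv_all_nth in_set_conv_nth with_zero_def)
      moreover from this have "ps ! i \<in> I" using ps by auto
      ultimately show "y \<in> carrier S"
        using component_closed[of y "fst (ps ! i)"] I(1)[of "ps ! i"] by auto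
    qed
    then show "x \<in> carrier S" using xs(1) joins_closed by simp
  qed
  moreover have "(\<lambda>f. joins S (map f ps)) \<in> sba_iso ?P S" if ps: "distinct ps" "set ps = I" for ps
    by (rule sba_iso_inverse[OF closed iso]) (rule recombine[OF ps])
  moreover have "orthogonal S (component (fst p)) (component (fst q))"
    if "p \<in> I" "q \<in> I" "p \<noteq> q" for p q
    unfolding orthogonal_def
  proof (intro ballI)
    fix x y assume "x \<in> component (fst p)" "y \<in> component (fst q)"
    then show "x \<sqinter> y = \<zero>"
      using proj_orthogonal[of x y "fst p" "fst q"] that I fst_eq
      by (simp add: proj_component component_closed)
  qed
  moreover have "nonzero_D_class S (component (fst p))" if "p \<in> I" for p
    using I[OF that] nz by (intro component_D_class) auto
  ultimately show ?sum unfolding is_direct_sum_def using fin by blast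
qed

end

section \<open>Atomic classes\<close>

context skew_boolean_algebra
begin

lemma meets_closed: "xs \<noteq> [] \<Longrightarrow> set xs \<subseteq> carrier S \<Longrightarrow> meets S xs \<in> carrier S"
  by (induction xs rule: induct_list012) auto

lemma hom_meets:
  "h \<in> sba_hom S T \<Longrightarrow> xs \<noteq> [] \<Longrightarrow> set xs \<subseteq> carrier S \<Longrightarrow> h (meets S xs) = meets T (map h xs)"
  by (induction xs rule: induct_list012) (simp_all add: sba_homD meets_closed)

lemma meets_below:
  "x \<in> set xs \<Longrightarrow> set xs \<subseteq> carrier S \<Longrightarrow> meets S xs \<preceq> x"
proof (induction xs rule: induct_list012)
  case (3 y z xs)
  let ?m = "meets S (z # xs)"
  have c: "y \<in> carrier S" "?m \<in> carrier S" using 3 meets_closed[of "z # xs"] by auto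
  show ?case
  proof (cases "x = y")
    case True
    then show ?thesis using c below_meet_left[of y ?m] by simp
  next
    case False
    then show ?thesis
      using 3 c below_meet_right[of y ?m] below_trans[of "y \<sqinter> ?m" ?m x] by auto
  qed
qed auto

lemma meet_joins_zero:
  assumes "x \<in> carrier S" "set xs \<subseteq> carrier S" "x \<sqinter> joins S xs = \<zero>" "y \<in> set xs"
  shows "x \<sqinter> y = \<zero>"
  using assms
proof (induction xs)
  case (Cons z xs)
  then have "x \<sqinter> z \<squnion> x \<sqinter> joins S xs = \<zero>" by (simp add: distrib_left joins_closed)
  then have "x \<sqinter> z = \<zero>" "x \<sqinter> joins S xs = \<zero>"
    using Cons.prems join_eq_zero[of "x \<sqinter> z" "x \<sqinter> joins S xs"] by (simp_all add: joins_closed)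
  then show ?case using Cons by auto
qed simp

end

lemma (in left_handed_sba) meet_eq_left:
  "x \<in> carrier S \<Longrightarrow> y \<in> carrier S \<Longrightarrow> x \<preceq> y \<Longrightarrow> x \<sqinter> y = x"
  by (metis left_meet)

lemma (in right_handed_sba) meet_eq_right:
  "x \<in> carrier S \<Longrightarrow> y \<in> carrier S \<Longrightarrow> y \<preceq> x \<Longrightarrow> x \<sqinter> y = y"
  by (metis right_meet)

context generated_sba
begin

text \<open>
  The element \<open>e = m \<setminus> j\<close>, with \<open>m\<close> the meet of the generators in \<open>L\<close> and \<open>j\<close> the join of the others,
  lies in the cell of \<open>L\<close>, so it is its own projection. But the projection kills \<open>j\<close>, so \<open>e\<close> is
  the projection of \<open>m\<close>.
\<close>

lemma atom_elem_eq:
  assumes ys: "set ys = L" and zs: "set zs = set us - L" and L: "L \<subseteq> set us" "L \<noteq> {}"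
  shows "atom_elem S (map g ys) (map g zs) = meets S (map (part L) ys)"
proof -
  let ?m = "meets S (map g ys)" and ?j = "joins S (map g zs)"
  have sub: "set (map g ys) \<subseteq> carrier S" "set (map g zs) \<subseteq> carrier S"
    using ys zs L by auto
  have ne: "map g ys \<noteq> []" using ys L by auto
  have c: "?m \<in> carrier S" "?j \<in> carrier S"
    using meets_closed[OF ne sub(1)] joins_closed[OF sub(2)] .
  \<comment> \<open>If \<open>zs\<close> is empty then \<open>?j = 0\<close>, and \<open>?m \<setminus> 0 = ?m\<close> agrees with the separate clause of \<open>atom_elem\<close>.\<close>
  define e where "e = ?m \<setminus> ?j"
  have ec: "e \<in> carrier S" and em: "e \<preceq> ?m" and ej: "e \<sqinter> ?j = \<zero>"
    using c diff_absorb[of ?m ?j] diff_meet_zero[of ?m ?j] by (simp_all add: e_def)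
  have "proj L e = e"
  proof (intro cell_map_fixes gens ec)
    fix u assume "u \<in> set us" "u \<in> L"
    then show "e \<preceq> g u"
      using meets_below[of "g u" "map g ys"] sub ys below_trans[of e ?m "g u"] c ec em by auto
  next
    fix u assume "u \<in> set us" "u \<notin> L"
    then show "e \<sqinter> g u = \<zero>"
      using meet_joins_zero[OF ec sub(2) ej, of "g u"] zs by auto
  qed
  moreover have "proj L e = proj L ?m \<setminus> proj L ?j" using c by (simp add: e_def)
  moreover have "proj L ?j = \<zero>"
  proof -
    have "joins S (map (\<lambda>u. proj L (g u)) vs) = \<zero>" if "set vs \<subseteq> set us - L" for vs
      using that by (induction vs) (auto simp: proj_gen_outside)
    then show ?thesis using hom_joins[OF proj_hom sub(2)] zs by (simp add: comp_def)
  qed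
  moreover have "proj L ?m = meets S (map (part L) ys)"
    using hom_meets[OF proj_hom ne sub(1)] by (simp add: comp_def part_def[abs_def])
  moreover have "proj L ?m \<in> carrier S" using c by simp
  ultimately have "e = meets S (map (part L) ys)"
    by (simp add: diff_of_orthogonal)
  moreover have "atom_elem S (map g ys) (map g zs) = e"
    using c by (simp add: atom_elem_def e_def diff_of_orthogonal)
  ultimately show ?thesis by simp
qed

lemma atom_class_eq:
  assumes p: "p \<in> ordered_partitions (set us)"
  shows "atom_class S g p = {meets S (map (part (fst p)) ys) |ys. distinct ys \<and> set ys = fst p}"
proof -
  obtain L M where LM: "p = (L, M)" by fastforce
  have L: "L \<subseteq> set us" "L \<noteq> {}" and M: "M = set us - L"
    using p LM by (auto simp: ordered_partitions_def)
  obtain zs where zs: "distinct zs" "set zs = M"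
    using M finite_distinct_list[of M] by auto
  have eq: "atom_elem S (map g ys) (map g zs) = meets S (map (part L) ys)"
    if "set ys = L" "set zs = M" for ys zs
    using that L M by (intro atom_elem_eq) auto
  show ?thesis
    unfolding atom_class_def LM split fst_conv
  proof (intro equalityI subsetI)
    fix x assume "x \<in> {meets S (map (part L) ys) |ys. distinct ys \<and> set ys = L}"
    then obtain ys where ys: "x = meets S (map (part L) ys)" "distinct ys" "set ys = L" by auto
    then have "x = atom_elem S (map g ys) (map g zs)" using eq zs(2) by simp
    with ys zs show "x \<in> {atom_elem S (map g ys) (map g zs) |ys zs.
        distinct ys \<and> set ys = L \<and> distinct zs \<and> set zs = M}" by blast
  qed (auto simp: eq)
qed

lemma component_if_left_handed:
  assumes "left_handed_sba S" "L \<subseteq> set us"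
  shows "u \<in> L \<Longrightarrow> v \<in> L \<Longrightarrow> part L u \<sqinter> part L v = part L u"
    and "component L = part L ` L"
proof -
  interpret left_handed_sba S by fact
  show *: "part L u \<sqinter> part L v = part L u" if "u \<in> L" "v \<in> L" for u v
    using meet_eq_left[OF _ _ part_below] that assms(2) by simp
  show "component L = part L ` L"
  proof (intro equalityI subsetI)
    fix x assume "x \<in> component L"
    then obtain u v where "u \<in> L" "v \<in> L" "x = part L u \<sqinter> part L v"
      by (auto simp: component_def)
    then show "x \<in> part L ` L" using * by simp
  qed (use part_in_component[OF _ assms(2)] in blast)
qed

lemma component_if_right_handed:
  assumes "right_handed_sba S" "L \<subseteq> set us"
  shows "u \<in> L \<Longrightarrow> v \<in> L \<Longrightarrow> part L u \<sqinter> part L v = part L v"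
    and "component L = part L ` L"
proof -
  interpret right_handed_sba S by fact
  show *: "part L u \<sqinter> part L v = part L v" if "u \<in> L" "v \<in> L" for u v
    using meet_eq_right[OF _ _ part_below] that assms(2) by simp
  show "component L = part L ` L"
  proof (intro equalityI subsetI)
    fix x assume "x \<in> component L"
    then obtain u v where "u \<in> L" "v \<in> L" "x = part L u \<sqinter> part L v"
      by (auto simp: component_def)
    then show "x \<in> part L ` L" using * by simp
  qed (use part_in_component[OF _ assms(2)] in blast)
qed

text \<open>
  A meet of parts is its first factor, and every element of \<open>L\<close> comes first in some enumeration of \<open>L\<close>.
\<close>

lemma atom_class_left_handed:
  assumes "left_handed_sba S" and p: "p \<in> ordered_partitions (set us)"
  shows "atom_class S g p = component (fst p)"
proof -
  let ?L = "fst p"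
  have L: "?L \<subseteq> set us" using p by (auto simp: ordered_partitions_def)
  note rect = component_if_left_handed[OF assms(1) L]
  have head: "meets S (map (part ?L) (y # ys)) = part ?L y" if "set (y # ys) \<subseteq> ?L" for y ys
    using that by (induction ys arbitrary: y) (auto simp: rect)
  show ?thesis
    unfolding atom_class_eq[OF p] rect(2)
  proof (intro equalityI subsetI)
    fix x assume "x \<in> {meets S (map (part ?L) ys) |ys. distinct ys \<and> set ys = ?L}"
    then obtain ys where ys: "x = meets S (map (part ?L) ys)" "set ys = ?L" by auto
    moreover have "ys \<noteq> []" using p ys by (auto simp: ordered_partitions_def)
    ultimately show "x \<in> part ?L ` ?L" using head[of "hd ys" "tl ys"] by force
  next
    fix x assume "x \<in> part ?L ` ?L"
    then obtain u where u: "u \<in> ?L" "x = part ?L u" by auto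
    obtain ys where "distinct ys" "set ys = ?L - {u}"
      using finite_distinct_list[of "?L - {u}"] finite_subset[OF L] by auto
    then have "distinct (u # ys)" "set (u # ys) = ?L" using u by auto
    then show "x \<in> {meets S (map (part ?L) ys) |ys. distinct ys \<and> set ys = ?L}"
      using head[of u ys] u by (intro CollectI exI[of _ "u # ys"]) simp
  qed
qed

text \<open>
  A meet of parts is its last factor, and every element of \<open>L\<close> comes last in some enumeration of \<open>L\<close>.
\<close>

lemma atom_class_right_handed:
  assumes "right_handed_sba S" and p: "p \<in> ordered_partitions (set us)"
  shows "atom_class S g p = component (fst p)"
proof -
  let ?L = "fst p"
  have L: "?L \<subseteq> set us" using p by (auto simp: ordered_partitions_def)
  note rect = component_if_right_handed[OF assms(1) L]
  have last: "meets S (map (part ?L) ys) = part ?L (last ys)" if "ys \<noteq> []" "set ys \<subseteq> ?L" for ys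
    using that
  proof (induction ys rule: induct_list012)
    case (3 y z ys)
    then show ?case using rect(1)[of y "last (z # ys)"] last_in_set[of "z # ys"] by auto
  qed auto
  show ?thesis
    unfolding atom_class_eq[OF p] rect(2)
  proof (intro equalityI subsetI)
    fix x assume "x \<in> {meets S (map (part ?L) ys) |ys. distinct ys \<and> set ys = ?L}"
    then obtain ys where ys: "x = meets S (map (part ?L) ys)" "set ys = ?L" by auto
    moreover have "ys \<noteq> []" using p ys by (auto simp: ordered_partitions_def)
    ultimately show "x \<in> part ?L ` ?L" using last[of ys] last_in_set[of ys] by auto
  next
    fix x assume "x \<in> part ?L ` ?L"
    then obtain u where u: "u \<in> ?L" "x = part ?L u" by auto
    obtain ys where "distinct ys" "set ys = ?L - {u}"
      using finite_distinct_list[of "?L - {u}"] finite_subset[OF L] by auto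
    then have "distinct (ys @ [u])" "set (ys @ [u]) = ?L" using u by auto
    then show "x \<in> {meets S (map (part ?L) ys) |ys. distinct ys \<and> set ys = ?L}"
      using last[of "ys @ [u]"] u by (intro CollectI exI[of _ "ys @ [u]"]) simp
  qed
qed

text \<open>
  Suppose that \<open>h\<close> sends the generators outside \<open>L\<close> to \<open>0\<close> and those in \<open>L\<close> to elements that lie
  \<open>\<preceq>\<close>-above all of \<open>Q\<close>. Then the cell of \<open>L\<close> in \<open>Q\<close> is all of \<open>Q\<close>, so \<open>h\<close> is unchanged by first projecting
  onto the cell of \<open>L\<close> in \<open>S\<close>. Hence \<open>h\<close> maps the part of \<open>u\<close> to \<open>h (g u)\<close>, and its restriction to the
  component is bijective as soon as it does not identify distinct products of parts.
\<close>

lemma component_iso: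
  assumes Q: "skew_boolean_algebra Q" and h: "h \<in> sba_hom S Q" and L: "L \<subseteq> set us"
    and outside: "\<And>u. u \<in> set us \<Longrightarrow> u \<notin> L \<Longrightarrow> h (g u) = \<zero>\<^bsub>Q\<^esub>"
    and inside: "\<And>x u. x \<in> carrier Q \<Longrightarrow> u \<in> L \<Longrightarrow> x \<sqinter>\<^bsub>Q\<^esub> h (g u) \<sqinter>\<^bsub>Q\<^esub> x = x"
    and onto: "carrier Q = insert \<zero>\<^bsub>Q\<^esub> {h (g u) \<sqinter>\<^bsub>Q\<^esub> h (g v) |u v. u \<in> L \<and> v \<in> L}"
    and nonzero: "\<And>u v. u \<in> L \<Longrightarrow> v \<in> L \<Longrightarrow> h (g u) \<sqinter>\<^bsub>Q\<^esub> h (g v) \<noteq> \<zero>\<^bsub>Q\<^esub>"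
    and inj: "\<And>u v u' v'. u \<in> L \<Longrightarrow> v \<in> L \<Longrightarrow> u' \<in> L \<Longrightarrow> v' \<in> L \<Longrightarrow>
      h (g u) \<sqinter>\<^bsub>Q\<^esub> h (g v) = h (g u') \<sqinter>\<^bsub>Q\<^esub> h (g v') \<Longrightarrow>
      part L u \<sqinter> part L v = part L u' \<sqinter> part L v'"
  shows "\<zero> \<notin> component L" and "with_zero S (component L) \<simeq> Q"
proof -
  have h_proj: "h (proj L x) = h x" if "x \<in> carrier S" for x
  proof -
    interpret Q: skew_boolean_algebra Q by fact
    have "h (proj L x) = cell_map Q (\<lambda>u. h (g u)) L us (h x)"
      using that by (rule hom_cell_map[OF skew_boolean_algebra_axioms h gens])
    also have "\<dots> = h x"
      using that gens inside outside sba_homD(1)[OF h] by (intro Q.cell_map_fixes) auto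
    finally show ?thesis .
  qed
  have h_part: "h (part L u \<sqinter> part L v) = h (g u) \<sqinter>\<^bsub>Q\<^esub> h (g v)" if "u \<in> L" "v \<in> L" for u v
    using that L by (simp add: sba_homD[OF h]) (auto simp: part_def h_proj subset_iff)
  have h_nz: "h x \<noteq> \<zero>\<^bsub>Q\<^esub>" if "x \<in> component L" for x
    using that h_part nonzero by (auto simp: component_def)
  then show nz: "\<zero> \<notin> component L" using sba_homD(5)[OF h] by auto
  have "h \<in> sba_hom (with_zero S (component L)) Q"
  proof -
    have "x \<in> carrier S" if "x \<in> carrier (with_zero S (component L))" for x
      using that component_closed[OF _ L] by (auto simp: with_zero_def)
    then show ?thesis
      using h by (simp add: sba_hom_def Pi_iff) (simp add: with_zero_def)
  qed
  moreover have "inj_on h (insert \<zero> (component L))"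
  proof (rule inj_onI)
    fix x y assume "x \<in> insert \<zero> (component L)" "y \<in> insert \<zero> (component L)" "h x = h y"
    then consider "x = \<zero>" "y = \<zero>" | "x \<in> component L" "y \<in> component L"
      using h_nz sba_homD(5)[OF h] by fastforce
    then show "x = y"
    proof cases
      case 2
      then obtain u v u' v' where "u \<in> L" "v \<in> L" "x = part L u \<sqinter> part L v"
        "u' \<in> L" "v' \<in> L" "y = part L u' \<sqinter> part L v'"
        unfolding component_def by blast
      then show ?thesis using \<open>h x = h y\<close> inj[of u v u' v'] h_part by simp
    qed simp
  qed
  moreover have "h ` insert \<zero> (component L) = carrier Q"
  proof -
    have "h ` component L = {h (g u) \<sqinter>\<^bsub>Q\<^esub> h (g v) |u v. u \<in> L \<and> v \<in> L}"
      unfolding component_def image_Collect using h_part by (intro Collect_cong) metis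
    then show ?thesis unfolding onto using sba_homD(5)[OF h] by simp
  qed
  ultimately show "with_zero S (component L) \<simeq> Q"
    by (auto simp: sba_isomorphic_def sba_iso_def bij_betw_def with_zero_def)
qed

end

section \<open>Products\<close>

lemma trivial_sba_isomorphic:
  assumes "closed_algebra S" "carrier S = {\<zero>\<^bsub>S\<^esub>}" "closed_algebra T" "carrier T = {\<zero>\<^bsub>T\<^esub>}"
  shows "S \<simeq> T"
proof -
  interpret S: closed_algebra S by fact
  interpret T: closed_algebra T by fact
  show ?thesis
    using S.closed T.closed assms(2,4)
    by (intro sba_isomorphicI[of "\<lambda>_. \<zero>\<^bsub>T\<^esub>" _ _ "\<lambda>_. \<zero>\<^bsub>S\<^esub>"]) (auto simp: sba_hom_def)
qed

lemma closed_algebra_prod: "(\<And>i. i \<in> I \<Longrightarrow> closed_algebra (A i)) \<Longrightarrow> closed_algebra (sba_prod I A)"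
  by unfold_locales (auto simp: sba_prod_def closed_algebra_def PiE_iff)

lemma sba_prod_cong: "(\<And>i. i \<in> I \<Longrightarrow> A i = B i) \<Longrightarrow> sba_prod I A = sba_prod I B"
  by (simp add: sba_prod_def cong: restrict_cong PiE_cong)

lemma sba_prod_isomorphic:
  assumes "\<And>i. i \<in> I \<Longrightarrow> A i \<simeq> B i"
  shows "sba_prod I A \<simeq> sba_prod I B"
proof -
  note sba_isomorphicD[OF assms]
  then obtain h k where hk: "\<And>i. i \<in> I \<Longrightarrow> h i \<in> sba_hom (A i) (B i) \<and>
      (\<forall>y\<in>carrier (B i). k i y \<in> carrier (A i)) \<and>
      (\<forall>x\<in>carrier (A i). k i (h i x) = x) \<and> (\<forall>y\<in>carrier (B i). h i (k i y) = y)"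
    by metis
  show ?thesis
    using hk
    by (intro sba_isomorphicI[of "\<lambda>f. \<lambda>i\<in>I. h i (f i)" _ _ "\<lambda>f. \<lambda>i\<in>I. k i (f i)"])
      (auto simp: sba_hom_def sba_prod_def fun_eq_iff PiE_iff Pi_iff extensional_def)
qed

lemma sba_prod_reindex:
  assumes "bij_betw \<sigma> J I"
  shows "sba_prod I A \<simeq> sba_prod J (\<lambda>j. A (\<sigma> j))"
proof -
  let ?\<tau> = "inv_into J \<sigma>"
  have st: "\<And>j. j \<in> J \<Longrightarrow> \<sigma> j \<in> I" "\<And>i. i \<in> I \<Longrightarrow> ?\<tau> i \<in> J"
    "\<And>j. j \<in> J \<Longrightarrow> ?\<tau> (\<sigma> j) = j" "\<And>i. i \<in> I \<Longrightarrow> \<sigma> (?\<tau> i) = i"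
    using assms bij_betw_inv_into_left[OF assms] bij_betw_inv_into_right[OF assms]
      bij_betw_apply[OF assms] bij_betw_apply[OF bij_betw_inv_into[OF assms]] by auto
  have back_closed: "(\<lambda>i\<in>I. f (?\<tau> i)) \<in> carrier (sba_prod I A)"
    if "f \<in> carrier (sba_prod J (\<lambda>j. A (\<sigma> j)))" for f
  proof -
    have "f (?\<tau> i) \<in> carrier (A i)" if "i \<in> I" for i
    proof -
      have "f \<in> (\<Pi>\<^sub>E j\<in>J. carrier (A (\<sigma> j)))"
        using \<open>f \<in> carrier _\<close> by (simp add: sba_prod_def)
      then have "f (?\<tau> i) \<in> carrier (A (\<sigma> (?\<tau> i)))" using st(2)[OF that] by (rule PiE_mem)
      then show ?thesis using st(4)[OF that] by simp
    qed
    then show ?thesis by (simp add: sba_prod_def)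
  qed
  show ?thesis
    by (rule sba_isomorphicI[of "\<lambda>f. \<lambda>j\<in>J. f (\<sigma> j)" _ _ "\<lambda>f. \<lambda>i\<in>I. f (?\<tau> i)"])
      (use st back_closed in \<open>auto simp: sba_hom_def sba_prod_def fun_eq_iff PiE_iff extensional_def\<close>)
qed

lemma sba_prod_const_isomorphic_power:
  assumes "finite I" "card I = m"
  shows "sba_prod I (\<lambda>_. A) \<simeq> sba_power A m"
proof -
  obtain \<sigma> where "bij_betw \<sigma> {..<m} I"
    using assms finite_same_card_bij[of "{..<m}" I] by auto
  then show ?thesis unfolding sba_power_def by (rule sba_prod_reindex)
qed

lemma sba_prod_fibres:
  assumes "f ` I \<subseteq> K"
  shows "sba_prod I (\<lambda>i. A (f i)) \<simeq> sba_prod K (\<lambda>k. sba_prod {i \<in> I. f i = k} (\<lambda>_. A k))"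
proof -
  have f: "f i \<in> K" if "i \<in> I" for i using assms that by auto
  show ?thesis
    by (rule sba_isomorphicI[of "\<lambda>x. \<lambda>k\<in>K. \<lambda>i\<in>{i \<in> I. f i = k}. x i" _ _
        "\<lambda>y. \<lambda>i\<in>I. y (f i) i"])
      (use f in \<open>auto simp: sba_hom_def sba_prod_def fun_eq_iff PiE_iff extensional_def
        split: if_splits\<close>)
qed

lemma sba_prod_insert:
  assumes "a \<notin> I"
  shows "sba_prod (insert a I) A \<simeq> A a \<times>\<^sub>S sba_prod I A"
  by (rule sba_isomorphicI[of "\<lambda>f. (f a, restrict f I)" _ _ "\<lambda>(x, f). f(a := x)"])
    (use assms in \<open>auto simp: sba_hom_def sba_prod_def sba_times_def fun_eq_iff PiE_iff
      extensional_def\<close>)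

lemma sba_times_isomorphic:
  assumes "A \<simeq> A'" "B \<simeq> B'"
  shows "A \<times>\<^sub>S B \<simeq> A' \<times>\<^sub>S B'"
proof -
  obtain h k where "h \<in> sba_hom A A'" "\<And>y. y \<in> carrier A' \<Longrightarrow> k y \<in> carrier A"
    "\<And>x. x \<in> carrier A \<Longrightarrow> k (h x) = x" "\<And>y. y \<in> carrier A' \<Longrightarrow> h (k y) = y"
    using sba_isomorphicD[OF assms(1)] by blast
  moreover obtain h' k' where "h' \<in> sba_hom B B'" "\<And>y. y \<in> carrier B' \<Longrightarrow> k' y \<in> carrier B"
    "\<And>x. x \<in> carrier B \<Longrightarrow> k' (h' x) = x" "\<And>y. y \<in> carrier B' \<Longrightarrow> h' (k' y) = y"
    using sba_isomorphicD[OF assms(2)] by blast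
  ultimately show ?thesis
    by (intro sba_isomorphicI[of "map_prod h h'" _ _ "map_prod k k'"])
      (auto simp: sba_hom_def sba_times_def)
qed

lemma fibered_isomorphic:
  assumes "A \<simeq> A'" "B \<simeq> B'" "\<zero>\<^bsub>A\<^esub> \<in> carrier A" "\<zero>\<^bsub>B\<^esub> \<in> carrier B"
  shows "A \<bullet> B \<simeq> A' \<bullet> B'"
proof -
  obtain h k where h: "h \<in> sba_hom A A'" "\<And>y. y \<in> carrier A' \<Longrightarrow> k y \<in> carrier A"
    "\<And>x. x \<in> carrier A \<Longrightarrow> k (h x) = x" "\<And>y. y \<in> carrier A' \<Longrightarrow> h (k y) = y"
    using sba_isomorphicD[OF assms(1)] by blast
  obtain h' k' where h': "h' \<in> sba_hom B B'" "\<And>y. y \<in> carrier B' \<Longrightarrow> k' y \<in> carrier B"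
    "\<And>x. x \<in> carrier B \<Longrightarrow> k' (h' x) = x" "\<And>y. y \<in> carrier B' \<Longrightarrow> h' (k' y) = y"
    using sba_isomorphicD[OF assms(2)] by blast
  have z: "h x = \<zero>\<^bsub>A'\<^esub> \<longleftrightarrow> x = \<zero>\<^bsub>A\<^esub>" if "x \<in> carrier A" for x
    using that h(3)[OF that] h(3)[OF assms(3)] sba_homD(5)[OF h(1)] by metis
  have z': "h' x = \<zero>\<^bsub>B'\<^esub> \<longleftrightarrow> x = \<zero>\<^bsub>B\<^esub>" if "x \<in> carrier B" for x
    using that h'(3)[OF that] h'(3)[OF assms(4)] sba_homD(5)[OF h'(1)] by metis
  have k: "k y = \<zero>\<^bsub>A\<^esub> \<longleftrightarrow> y = \<zero>\<^bsub>A'\<^esub>" if "y \<in> carrier A'" for y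
    using z[of "k y"] h that by auto
  have k': "k' y = \<zero>\<^bsub>B\<^esub> \<longleftrightarrow> y = \<zero>\<^bsub>B'\<^esub>" if "y \<in> carrier B'" for y
    using z'[of "k' y"] h' that by auto
  show ?thesis
  proof (rule sba_isomorphicI[of "map_prod h h'" _ _ "map_prod k k'"])
    show "map_prod h h' \<in> sba_hom (A \<bullet> B) (A' \<bullet> B')"
      using sba_homD[OF h(1)] sba_homD[OF h'(1)] z z'
      by (auto simp: sba_hom_def fibered_def sba_times_def)
  qed (use h h' k k' in \<open>auto simp: fibered_def\<close>)
qed

text \<open>
  An ordered partition is determined by its first block, which is an arbitrary nonempty subset.
\<close>

lemma card_ordered_partitions:
  assumes "finite X" "k \<ge> 1"
  shows "card {p \<in> ordered_partitions X. card (fst p) = k} = card X choose k"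
proof -
  let ?I = "{p \<in> ordered_partitions X. card (fst p) = k}"
  have "fst ` ?I = {L. L \<subseteq> X \<and> card L = k}"
  proof -
    have "fst ` ?I = {L \<in> fst ` ordered_partitions X. card L = k}" by auto
    then show ?thesis using assms unfolding fst_ordered_partitions by auto
  qed
  moreover have "inj_on fst ?I"
    using ordered_partitions_fst_inj by (rule inj_on_subset) auto
  ultimately show ?thesis using n_subsets[OF assms(1), of k] card_image by fastforce
qed

text \<open>
  For \<open>k = 0\<close> no ordered partition is left, while the right-hand side has the factor \<open>Q 0\<close> to the
  power \<open>n choose 0 = 1\<close>; the two agree because \<open>Q 0\<close> is trivial.
\<close>

lemma sba_prod_ordered_partitions:
  assumes X: "finite X" "card X = n" and S: "S \<simeq> sba_prod (ordered_partitions X) C"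
    and C: "\<And>p. p \<in> ordered_partitions X \<Longrightarrow> C p \<simeq> Q (card (fst p))"
    and Q: "closed_algebra (Q 0)" "carrier (Q 0) = {\<zero>\<^bsub>Q 0\<^esub>}"
  shows "S \<simeq> sba_prod {0..n} (\<lambda>k. sba_power (Q k) (n choose k))"
proof -
  let ?I = "ordered_partitions X"
  have "card (fst p) \<in> {1..n}" if "p \<in> ?I" for p
  proof -
    have "fst p \<subseteq> X" "fst p \<noteq> {}" using that by (auto simp: ordered_partitions_def)
    then show ?thesis
      using X card_mono[of X "fst p"] card_gt_0_iff[of "fst p"] finite_subset[of "fst p" X]
      by auto
  qed
  then have sizes: "(\<lambda>p. card (fst p)) ` ?I \<subseteq> {1..n}" by blast
  have "S \<simeq> sba_prod ?I (\<lambda>p. Q (card (fst p)))"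
    using S sba_prod_isomorphic[OF C] by (rule sba_isomorphic_trans)
  moreover have "sba_prod ?I (\<lambda>p. Q (card (fst p))) \<simeq>
      sba_prod {0..n} (\<lambda>k. sba_prod {p \<in> ?I. card (fst p) = k} (\<lambda>_. Q k))"
    using sizes by (intro sba_prod_fibres) fastforce
  moreover have "sba_prod {p \<in> ?I. card (fst p) = k} (\<lambda>_. Q k) \<simeq> sba_power (Q k) (n choose k)"
    if "k \<in> {0..n}" for k
  proof (cases "k = 0")
    case True
    then have "{p \<in> ?I. card (fst p) = k} = {}" using sizes by force
    then show ?thesis
      unfolding True sba_power_def using Q
      by (intro trivial_sba_isomorphic closed_algebra_prod)
        (auto simp: sba_prod_def PiE_iff extensional_def fun_eq_iff)
  next
    case False
    then show ?thesis
      using X finite_ordered_partitions[OF X(1)] card_ordered_partitions[OF X(1), of k]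
      by (intro sba_prod_const_isomorphic_power) auto
  qed
  then have "sba_prod {0..n} (\<lambda>k. sba_prod {p \<in> ?I. card (fst p) = k} (\<lambda>_. Q k)) \<simeq>
      sba_prod {0..n} (\<lambda>k. sba_power (Q k) (n choose k))"
    by (rule sba_prod_isomorphic)
  ultimately show ?thesis by (blast intro: sba_isomorphic_trans)
qed

section \<open>Primitive algebras\<close>

text \<open>
  The class of \<open>0\<close> is always \<open>{0}\<close>, so having exactly one other class means that any two nonzero
  elements are \<open>\<D>\<close>-related.
\<close>

lemma primitive_iff:
  "primitive S \<longleftrightarrow> skew_boolean_algebra S \<and> carrier S \<noteq> {\<zero>\<^bsub>S\<^esub>} \<and>
    (\<forall>x\<in>carrier S - {\<zero>\<^bsub>S\<^esub>}. \<forall>y\<in>carrier S - {\<zero>\<^bsub>S\<^esub>}. x \<sqinter>\<^bsub>S\<^esub> y \<sqinter>\<^bsub>S\<^esub> x = x)"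
  (is "_ \<longleftrightarrow> _ \<and> _ \<and> ?rect")
proof (cases "skew_boolean_algebra S")
  case True
  interpret skew_boolean_algebra S by fact
  have self: "x \<in> D_rel S `` {x}" if "x \<in> carrier S" for x
    using that by (simp add: D_rel_def)
  have zero: "D_rel S `` {\<zero>\<^bsub>S\<^esub>} = {\<zero>\<^bsub>S\<^esub>}" by (auto simp: D_rel_def)
  have fwd: "carrier S \<noteq> {\<zero>\<^bsub>S\<^esub>} \<and> ?rect"
    if D: "D \<noteq> {\<zero>\<^bsub>S\<^esub>}" "carrier S // D_rel S = {{\<zero>\<^bsub>S\<^esub>}, D}" for D
  proof
    show "carrier S \<noteq> {\<zero>\<^bsub>S\<^esub>}" using D zero by (auto simp: quotient_def)
    have "D_rel S `` {x} = D" if "x \<in> carrier S" "x \<noteq> \<zero>\<^bsub>S\<^esub>" for x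
      using quotientI[OF that(1), of "D_rel S"] self[OF that(1)] that(2) D by auto
    then have "y \<in> D_rel S `` {x}" if "x \<in> carrier S" "x \<noteq> \<zero>\<^bsub>S\<^esub>" "y \<in> carrier S" "y \<noteq> \<zero>\<^bsub>S\<^esub>" for x y
      using that self by blast
    then show ?rect by (auto simp: D_rel_def)
  qed
  have bwd: "carrier S // D_rel S = {{\<zero>\<^bsub>S\<^esub>}, carrier S - {\<zero>\<^bsub>S\<^esub>}} \<and> carrier S - {\<zero>\<^bsub>S\<^esub>} \<noteq> {\<zero>\<^bsub>S\<^esub>}"
    if ne: "carrier S \<noteq> {\<zero>\<^bsub>S\<^esub>}" and rect: ?rect
  proof -
    obtain e where e: "e \<in> carrier S" "e \<noteq> \<zero>\<^bsub>S\<^esub>" using ne zero_closed by blast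
    have "D_rel S `` {x} = carrier S - {\<zero>\<^bsub>S\<^esub>}" if "x \<in> carrier S" "x \<noteq> \<zero>\<^bsub>S\<^esub>" for x
      using that rect by (auto simp: D_rel_def)
    then have "carrier S // D_rel S = {{\<zero>\<^bsub>S\<^esub>}, carrier S - {\<zero>\<^bsub>S\<^esub>}}"
      unfolding quotient_def using e zero zero_closed by (auto 4 3)
    then show ?thesis by blast
  qed
  show ?thesis
  proof
    assume "primitive S"
    then obtain D where "D \<noteq> {\<zero>\<^bsub>S\<^esub>}" "carrier S // D_rel S = {{\<zero>\<^bsub>S\<^esub>}, D}"
      by (auto simp: primitive_def)
    from fwd[OF this] True show "skew_boolean_algebra S \<and> carrier S \<noteq> {\<zero>\<^bsub>S\<^esub>} \<and> ?rect" by simp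
  next
    assume "skew_boolean_algebra S \<and> carrier S \<noteq> {\<zero>\<^bsub>S\<^esub>} \<and> ?rect"
    then show "primitive S"
      using bwd True unfolding primitive_def by (intro conjI exI[of _ "carrier S - {\<zero>\<^bsub>S\<^esub>}"]) simp_all
  qed
qed (simp add: primitive_def)

lemma (in generated_sba) primitive_component:
  assumes "L \<subseteq> set us" "L \<noteq> {}" "\<zero> \<notin> component L"
  shows "primitive (with_zero S (component L))"
proof -
  obtain u where "u \<in> L" using assms by blast
  then have "part L u \<in> component L" using assms part_in_component by blast
  moreover from this have "part L u \<noteq> \<zero>" using assms by auto
  ultimately show ?thesis
    unfolding primitive_iff
    using sba_component[OF assms(1)] component_below[of _ L] assms(1)
    by (auto simp: with_zero_def)
qed

text \<open>
  The zeros of the operations of a primitive algebra depend only on which arguments are zero; this is what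
  makes the fibered product over \<open>2\<close> closed.
\<close>

lemma primitive_zero_iff:
  assumes S: "primitive S" and xy: "x \<in> carrier S" "y \<in> carrier S"
  shows "x \<sqinter>\<^bsub>S\<^esub> y = \<zero>\<^bsub>S\<^esub> \<longleftrightarrow> x = \<zero>\<^bsub>S\<^esub> \<or> y = \<zero>\<^bsub>S\<^esub>"
    and "x \<squnion>\<^bsub>S\<^esub> y = \<zero>\<^bsub>S\<^esub> \<longleftrightarrow> x = \<zero>\<^bsub>S\<^esub> \<and> y = \<zero>\<^bsub>S\<^esub>"
    and "x \<setminus>\<^bsub>S\<^esub> y = \<zero>\<^bsub>S\<^esub> \<longleftrightarrow> x = \<zero>\<^bsub>S\<^esub> \<or> y \<noteq> \<zero>\<^bsub>S\<^esub>"
proof -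
  interpret skew_boolean_algebra S using S by (simp add: primitive_iff)
  have rect: "x \<preceq> y" if "x \<noteq> \<zero>\<^bsub>S\<^esub>" "y \<noteq> \<zero>\<^bsub>S\<^esub>"
    using S xy that by (auto simp: primitive_iff)
  show "x \<sqinter>\<^bsub>S\<^esub> y = \<zero>\<^bsub>S\<^esub> \<longleftrightarrow> x = \<zero>\<^bsub>S\<^esub> \<or> y = \<zero>\<^bsub>S\<^esub>"
    using rect xy by (metis zero_laws(1,2))
  show "x \<squnion>\<^bsub>S\<^esub> y = \<zero>\<^bsub>S\<^esub> \<longleftrightarrow> x = \<zero>\<^bsub>S\<^esub> \<and> y = \<zero>\<^bsub>S\<^esub>"
    using join_eq_zero[OF xy] xy by auto
  show "x \<setminus>\<^bsub>S\<^esub> y = \<zero>\<^bsub>S\<^esub> \<longleftrightarrow> x = \<zero>\<^bsub>S\<^esub> \<or> y \<noteq> \<zero>\<^bsub>S\<^esub>"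
  proof (cases "x = \<zero>\<^bsub>S\<^esub> \<or> y = \<zero>\<^bsub>S\<^esub>")
    case True
    then show ?thesis using diff_of_orthogonal[OF xy] xy by auto
  next
    case False
    then show ?thesis using diff_of_below[OF xy rect] by auto
  qed
qed

lemma primitive_fibered:
  assumes "primitive P" "primitive Q"
  shows "primitive (P \<bullet> Q)"
proof -
  interpret P: skew_boolean_algebra P using assms by (simp add: primitive_iff)
  interpret Q: skew_boolean_algebra Q using assms by (simp add: primitive_iff)
  note [simp] = primitive_zero_iff[OF assms(1)] primitive_zero_iff[OF assms(2)]
  have diff_join': "x \<sqinter>\<^bsub>P\<^esub> (y \<sqinter>\<^bsub>P\<^esub> x) \<squnion>\<^bsub>P\<^esub> (x \<setminus>\<^bsub>P\<^esub> y) = x"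
    if "x \<in> carrier P" "y \<in> carrier P" for x y
    using that P.diff_join[of x y] by (simp add: P.meet_assoc)
  have diff_join'': "x \<sqinter>\<^bsub>Q\<^esub> (y \<sqinter>\<^bsub>Q\<^esub> x) \<squnion>\<^bsub>Q\<^esub> (x \<setminus>\<^bsub>Q\<^esub> y) = x"
    if "x \<in> carrier Q" "y \<in> carrier Q" for x y
    using that Q.diff_join[of x y] by (simp add: Q.meet_assoc)
  have "skew_boolean_algebra (P \<bullet> Q)"
    by unfold_locales
      (auto simp: fibered_def sba_times_def P.meet_assoc Q.meet_assoc P.join_assoc Q.join_assoc
        P.meet_absorb1 P.meet_absorb2 P.join_absorb1 P.join_absorb2
        Q.meet_absorb1 Q.meet_absorb2 Q.join_absorb1 Q.join_absorb2
        P.distrib_left P.distrib_right Q.distrib_left Q.distrib_right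
        P.diff_of_orthogonal Q.diff_of_orthogonal diff_join' diff_join''
        P.diff_meet1 Q.diff_meet1 P.diff_meet2 Q.diff_meet2)
  moreover obtain p q where "p \<in> carrier P" "p \<noteq> \<zero>\<^bsub>P\<^esub>" "q \<in> carrier Q" "q \<noteq> \<zero>\<^bsub>Q\<^esub>"
    using assms P.zero_closed Q.zero_closed unfolding primitive_iff by blast
  then have "(p, q) \<in> carrier (P \<bullet> Q)" "(p, q) \<noteq> \<zero>\<^bsub>P \<bullet> Q\<^esub>"
    by (auto simp: fibered_def sba_times_def)
  then have "carrier (P \<bullet> Q) \<noteq> {\<zero>\<^bsub>P \<bullet> Q\<^esub>}" by blast
  ultimately show ?thesis
    using assms unfolding primitive_iff by (auto simp: fibered_def sba_times_def)
qed

lemma primitive_prim_left: "k \<ge> 1 \<Longrightarrow> primitive (prim_left (k + 1))"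
proof -
  assume k: "k \<ge> 1"
  then have "left_handed_sba (prim_left (k + 1))" by (intro left_handed_prim_left) simp
  moreover have "1 \<in> carrier (prim_left (k + 1))" using k by (simp add: prim_left_def)
  ultimately show ?thesis
    by (auto simp: primitive_iff left_handed_sba_def prim_left_def)
qed

lemma primitive_prim_right: "k \<ge> 1 \<Longrightarrow> primitive (prim_right (k + 1))"
proof -
  assume k: "k \<ge> 1"
  then have "right_handed_sba (prim_right (k + 1))" by (intro right_handed_prim_right) simp
  moreover have "1 \<in> carrier (prim_right (k + 1))" using k by (simp add: prim_right_def)
  ultimately show ?thesis
    by (auto simp: primitive_iff right_handed_sba_def prim_right_def)
qed

lemma primitive_closed: "primitive S \<Longrightarrow> closed_algebra S"
proof -
  assume "primitive S"
  then interpret skew_boolean_algebra S by (simp add: primitive_iff)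
  show ?thesis by unfold_locales auto
qed

section \<open>Free algebras\<close>

text \<open>
  Every element of a free algebra is the class of a term, so this is induction over terms.
\<close>

lemma free_alg_generated:
  assumes x: "x \<in> carrier (free_alg V X)"
    and gen: "\<And>u. u \<in> X \<Longrightarrow> P (free_gen V X u)" and zero: "P \<zero>\<^bsub>free_alg V X\<^esub>"
    and meet: "\<And>x y. x \<in> carrier (free_alg V X) \<Longrightarrow> y \<in> carrier (free_alg V X) \<Longrightarrow> P x \<Longrightarrow> P y \<Longrightarrow>
      P (x \<sqinter>\<^bsub>free_alg V X\<^esub> y)"
    and join: "\<And>x y. x \<in> carrier (free_alg V X) \<Longrightarrow> y \<in> carrier (free_alg V X) \<Longrightarrow> P x \<Longrightarrow> P y \<Longrightarrow>
      P (x \<squnion>\<^bsub>free_alg V X\<^esub> y)"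
    and diff: "\<And>x y. x \<in> carrier (free_alg V X) \<Longrightarrow> y \<in> carrier (free_alg V X) \<Longrightarrow> P x \<Longrightarrow> P y \<Longrightarrow>
      P (x \<setminus>\<^bsub>free_alg V X\<^esub> y)"
  shows "P x"
proof -
  let ?c = "\<lambda>t. free_cong V X `` {t}"
  let ?T = "carrier (term_alg X)"
  note C = quot_simps[OF congruence_free_cong, of _ X _ V]
  have mem: "?c t \<in> carrier (free_alg V X)" if "t \<in> ?T" for t
    using that by (auto simp: free_alg_def quot_carrier)
  have ops: "?c (Meet s t) = ?c s \<sqinter>\<^bsub>free_alg V X\<^esub> ?c t"
    "?c (Join s t) = ?c s \<squnion>\<^bsub>free_alg V X\<^esub> ?c t"
    "?c (Diff s t) = ?c s \<setminus>\<^bsub>free_alg V X\<^esub> ?c t" if "s \<in> ?T" "t \<in> ?T" for s t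
    using C[OF that] unfolding free_alg_def by (simp_all add: term_alg_def)
  have "P (?c t)" if "t \<in> ?T" for t
    using that
  proof (induction t)
    case (Var u)
    then show ?case using gen[of u] by (simp add: free_gen_def term_alg_def)
  next
    case (Meet s t)
    then have "s \<in> ?T" "t \<in> ?T" by (auto simp: term_alg_def)
    then show ?case using meet[OF mem mem] Meet.IH by (simp only: ops)
  next
    case (Join s t)
    then have "s \<in> ?T" "t \<in> ?T" by (auto simp: term_alg_def)
    then show ?case using join[OF mem mem] Join.IH by (simp only: ops)
  next
    case (Diff s t)
    then have "s \<in> ?T" "t \<in> ?T" by (auto simp: term_alg_def)
    then show ?case using diff[OF mem mem] Diff.IH by (simp only: ops)
  next
    case Zero
    then show ?case using zero by (simp add: free_alg_def quot_zero term_alg_def)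
  qed
  then show ?thesis using x by (auto simp: free_alg_def quot_carrier)
qed

lemma generated_sba_free:
  assumes "skew_boolean_algebra (free_alg V (set us))" "distinct us"
  shows "generated_sba (free_alg V (set us)) (free_gen V (set us)) us"
proof -
  show ?thesis
  proof (intro generated_sba.intro generated_sba_axioms.intro assms)
    show "free_gen V (set us) \<in> set us \<rightarrow> carrier (free_alg V (set us))"
      by (auto simp: free_gen_def free_alg_def quot_carrier term_alg_def)
  qed (rule free_alg_generated[of _ V "set us"])
qed

text \<open>
  A criterion for the component of \<open>L\<close> to be isomorphic to a primitive algebra \<open>Q\<close>, for an algebra \<open>S\<close>
  that is free relative to \<open>Q\<close>. The nonzero elements of \<open>Q\<close> are the products of two among
  \<open>q 1, \<dots>, q k\<close>, where \<open>k\<close> is the size of \<open>L\<close>. The generators in \<open>L\<close> are sent to these \<open>k\<close> elements by a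
  numbering \<open>e\<close>. Which factors are recovered from a product in \<open>Q\<close> depends on the variety,
  so hypothesis \<open>inj\<close> only asks that they determine the product of parts in \<open>S\<close>.
\<close>

lemma (in generated_sba) component_model:
  fixes q :: "nat \<Rightarrow> 'b" and Q :: "'b sba"
  assumes Q: "skew_boolean_algebra Q" and L: "L \<subseteq> set us"
    and ext: "\<And>f. f \<in> set us \<rightarrow> carrier Q \<Longrightarrow> \<exists>h\<in>sba_hom S Q. \<forall>u\<in>set us. h (g u) = f u"
    and rect: "\<And>x i. x \<in> carrier Q \<Longrightarrow> i \<in> {1..card L} \<Longrightarrow> x \<sqinter>\<^bsub>Q\<^esub> q i \<sqinter>\<^bsub>Q\<^esub> x = x"
    and q: "\<And>i. i \<in> {1..card L} \<Longrightarrow> q i \<in> carrier Q"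
    and onto: "\<And>x. x \<in> carrier Q \<Longrightarrow> x \<noteq> \<zero>\<^bsub>Q\<^esub> \<Longrightarrow>
      \<exists>i\<in>{1..card L}. \<exists>j\<in>{1..card L}. x = q i \<sqinter>\<^bsub>Q\<^esub> q j"
    and nonzero: "\<And>i j. i \<in> {1..card L} \<Longrightarrow> j \<in> {1..card L} \<Longrightarrow> q i \<sqinter>\<^bsub>Q\<^esub> q j \<noteq> \<zero>\<^bsub>Q\<^esub>"
    and inj: "\<And>e u v u' v'. inj_on e L \<Longrightarrow> (\<And>w. w \<in> L \<Longrightarrow> e w \<noteq> 0) \<Longrightarrow>
      u \<in> L \<Longrightarrow> v \<in> L \<Longrightarrow> u' \<in> L \<Longrightarrow> v' \<in> L \<Longrightarrow>
      q (e u) \<sqinter>\<^bsub>Q\<^esub> q (e v) = q (e u') \<sqinter>\<^bsub>Q\<^esub> q (e v') \<Longrightarrow>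
      part L u \<sqinter> part L v = part L u' \<sqinter> part L v'"
  shows "\<zero> \<notin> component L \<and> with_zero S (component L) \<simeq> Q"
proof -
  interpret Q: skew_boolean_algebra Q by fact
  have "finite L" using L finite_subset by blast
  then obtain e where e: "bij_betw e L {1..card L}"
    using finite_same_card_bij[of L "{1..card L}"] by auto
  have e_in: "e u \<in> {1..card L}" if "u \<in> L" for u using bij_betw_apply[OF e that] .
  have e_onto: "\<exists>u\<in>L. e u = i" if "i \<in> {1..card L}" for i
    using bij_betw_imp_surj_on[OF e] that by (metis imageE)
  define f where "f u = (if u \<in> L then q (e u) else \<zero>\<^bsub>Q\<^esub>)" for u
  have "f \<in> set us \<rightarrow> carrier Q" using q[OF e_in] by (auto simp: f_def)
  from ext[OF this] obtain h where h: "h \<in> sba_hom S Q"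
    and hg: "\<And>u. u \<in> set us \<Longrightarrow> h (g u) = f u" by blast
  have hL: "h (g u) = q (e u)" if "u \<in> L" for u using that L hg by (auto simp: f_def)
  have "carrier Q = insert \<zero>\<^bsub>Q\<^esub> {h (g u) \<sqinter>\<^bsub>Q\<^esub> h (g v) |u v. u \<in> L \<and> v \<in> L}"
  proof (intro equalityI subsetI)
    fix x assume x: "x \<in> carrier Q"
    show "x \<in> insert \<zero>\<^bsub>Q\<^esub> {h (g u) \<sqinter>\<^bsub>Q\<^esub> h (g v) |u v. u \<in> L \<and> v \<in> L}"
    proof (cases "x = \<zero>\<^bsub>Q\<^esub>")
      case False
      then obtain i j where "i \<in> {1..card L}" "j \<in> {1..card L}" "x = q i \<sqinter>\<^bsub>Q\<^esub> q j"
        using onto[OF x] by blast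
      moreover from this obtain u v where "u \<in> L" "e u = i" "v \<in> L" "e v = j"
        using e_onto by meson
      ultimately have "x = h (g u) \<sqinter>\<^bsub>Q\<^esub> h (g v)" "u \<in> L" "v \<in> L" using hL by simp_all
      then show ?thesis by blast
    qed simp
  next
    fix x assume "x \<in> insert \<zero>\<^bsub>Q\<^esub> {h (g u) \<sqinter>\<^bsub>Q\<^esub> h (g v) |u v. u \<in> L \<and> v \<in> L}"
    then show "x \<in> carrier Q" using hL q[OF e_in] by auto
  qed
  note iso = component_iso[OF Q h L _ _ this]
  have props: "\<And>u. u \<in> set us \<Longrightarrow> u \<notin> L \<Longrightarrow> h (g u) = \<zero>\<^bsub>Q\<^esub>"
    "\<And>x u. x \<in> carrier Q \<Longrightarrow> u \<in> L \<Longrightarrow> x \<sqinter>\<^bsub>Q\<^esub> h (g u) \<sqinter>\<^bsub>Q\<^esub> x = x"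
    "\<And>u v. u \<in> L \<Longrightarrow> v \<in> L \<Longrightarrow> h (g u) \<sqinter>\<^bsub>Q\<^esub> h (g v) \<noteq> \<zero>\<^bsub>Q\<^esub>"
    using hg hL rect e_in nonzero by (simp_all add: f_def)
  have "part L u \<sqinter> part L v = part L u' \<sqinter> part L v'"
    if "u \<in> L" "v \<in> L" "u' \<in> L" "v' \<in> L" "h (g u) \<sqinter>\<^bsub>Q\<^esub> h (g v) = h (g u') \<sqinter>\<^bsub>Q\<^esub> h (g v')"
    for u v u' v'
    using that by (intro inj[of e, OF bij_betw_imp_inj_on[OF e]]) (use e_in hL in force)+
  from iso[OF props this] show ?thesis by blast
qed

lemma generated_sba_free_varieties:
  assumes "distinct us"
  shows "generated_sba (free_sba (set us)) (free_gen skew_boolean_algebra (set us)) us"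
    and "generated_sba (free_left_sba (set us)) (free_gen left_handed_sba (set us)) us"
    and "generated_sba (free_right_sba (set us)) (free_gen right_handed_sba (set us)) us"
  using free_in_variety[of "set us"] assms
  by (auto intro!: generated_sba_free simp: left_handed_sba_def right_handed_sba_def)

lemma free_left_component:
  fixes us :: "'v list"
  defines "F \<equiv> free_left_sba (set us)" and "g \<equiv> free_gen left_handed_sba (set us)"
  assumes us: "distinct us" and L: "L \<subseteq> set us"
  shows "\<zero>\<^bsub>F\<^esub> \<notin> generated_sba.component F g us L \<and>
    with_zero F (generated_sba.component F g us L) \<simeq> prim_left (card L + 1)"
proof -
  interpret generated_sba F g us
    unfolding F_def g_def using us by (rule generated_sba_free_varieties)
  let ?Q = "prim_left (card L + 1)"
  have Q: "left_handed_sba ?Q" by (rule left_handed_prim_left) simp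
  have "left_handed_sba F" unfolding F_def by (rule free_in_variety)
  note lh = component_if_left_handed(1)[OF this L]
  have ext: "\<exists>h\<in>sba_hom F ?Q. \<forall>u\<in>set us. h (g u) = f u" if "f \<in> set us \<rightarrow> carrier ?Q" for f
    using free_left_sba_universal[OF Q that] by (auto simp: extends_uniquely_def F_def g_def)
  have "skew_boolean_algebra ?Q" using Q by (simp add: left_handed_sba_def)
  then show ?thesis
  proof (rule component_model[OF _ L ext, where q = id])
    fix e :: "'v \<Rightarrow> nat" and u v u' v'
    assume "inj_on e L" "\<And>w. w \<in> L \<Longrightarrow> e w \<noteq> 0" and uv: "u \<in> L" "v \<in> L" "u' \<in> L" "v' \<in> L"
      and "id (e u) \<sqinter>\<^bsub>?Q\<^esub> id (e v) = id (e u') \<sqinter>\<^bsub>?Q\<^esub> id (e v')"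
    then have "u = u'" by (simp add: prim_left_def inj_on_eq_iff del: neq0_conv)
    then show "part L u \<sqinter>\<^bsub>F\<^esub> part L v = part L u' \<sqinter>\<^bsub>F\<^esub> part L v'" using uv by (simp add: lh)
  qed (auto simp: prim_left_def split: if_splits)
qed

lemma free_right_component:
  fixes us :: "'v list"
  defines "F \<equiv> free_right_sba (set us)" and "g \<equiv> free_gen right_handed_sba (set us)"
  assumes us: "distinct us" and L: "L \<subseteq> set us"
  shows "\<zero>\<^bsub>F\<^esub> \<notin> generated_sba.component F g us L \<and>
    with_zero F (generated_sba.component F g us L) \<simeq> prim_right (card L + 1)"
proof -
  interpret generated_sba F g us
    unfolding F_def g_def using us by (rule generated_sba_free_varieties)
  let ?Q = "prim_right (card L + 1)"
  have Q: "right_handed_sba ?Q" by (rule right_handed_prim_right) simp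
  have "right_handed_sba F" unfolding F_def by (rule free_in_variety)
  note rh = component_if_right_handed(1)[OF this L]
  have ext: "\<exists>h\<in>sba_hom F ?Q. \<forall>u\<in>set us. h (g u) = f u" if "f \<in> set us \<rightarrow> carrier ?Q" for f
    using free_right_sba_universal[OF Q that] by (auto simp: extends_uniquely_def F_def g_def)
  have "skew_boolean_algebra ?Q" using Q by (simp add: right_handed_sba_def)
  then show ?thesis
  proof (rule component_model[OF _ L ext, where q = id])
    fix e :: "'v \<Rightarrow> nat" and u v u' v'
    assume "inj_on e L" "\<And>w. w \<in> L \<Longrightarrow> e w \<noteq> 0" and uv: "u \<in> L" "v \<in> L" "u' \<in> L" "v' \<in> L"
      and "id (e u) \<sqinter>\<^bsub>?Q\<^esub> id (e v) = id (e u') \<sqinter>\<^bsub>?Q\<^esub> id (e v')"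
    then have "v = v'" by (simp add: prim_right_def inj_on_eq_iff del: neq0_conv)
    then show "part L u \<sqinter>\<^bsub>F\<^esub> part L v = part L u' \<sqinter>\<^bsub>F\<^esub> part L v'" using uv by (simp add: rh)
  qed (auto simp: prim_right_def split: if_splits)
qed

text \<open>
  In the fibered product, \<open>(i, i) \<sqinter> (j, j) = (i, j)\<close>: the left-handed coordinate remembers the first
  factor and the right-handed one the last, so all \<open>k\<^sup>2\<close> products of parts are distinct.
\<close>

lemma free_component:
  fixes us :: "'v list"
  defines "F \<equiv> free_sba (set us)" and "g \<equiv> free_gen skew_boolean_algebra (set us)"
  assumes us: "distinct us" and L: "L \<subseteq> set us" "L \<noteq> {}"
  shows "\<zero>\<^bsub>F\<^esub> \<notin> generated_sba.component F g us L \<and>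
    with_zero F (generated_sba.component F g us L) \<simeq>
      prim_left (card L + 1) \<bullet> prim_right (card L + 1)"
proof -
  interpret generated_sba F g us
    unfolding F_def g_def using us by (rule generated_sba_free_varieties)
  let ?Q = "prim_left (card L + 1) \<bullet> prim_right (card L + 1)"
  have "card L \<ge> 1" using L finite_subset[OF L(1)] by (simp add: Suc_le_eq card_gt_0_iff)
  then have Q: "skew_boolean_algebra ?Q"
    using primitive_fibered[OF primitive_prim_left primitive_prim_right] by (simp add: primitive_iff)
  have ext: "\<exists>h\<in>sba_hom F ?Q. \<forall>u\<in>set us. h (g u) = f u" if "f \<in> set us \<rightarrow> carrier ?Q" for f
    using free_sba_universal[OF Q that] by (auto simp: extends_uniquely_def F_def g_def)
  note Q_defs = fibered_def sba_times_def prim_left_def prim_right_def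
  from Q show ?thesis
  proof (rule component_model[OF _ L(1) ext, where q = "\<lambda>i. (i, i)"])
    fix e :: "'v \<Rightarrow> nat" and u v u' v'
    assume "inj_on e L" "\<And>w. w \<in> L \<Longrightarrow> e w \<noteq> 0" and uv: "u \<in> L" "v \<in> L" "u' \<in> L" "v' \<in> L"
      and "(e u, e u) \<sqinter>\<^bsub>?Q\<^esub> (e v, e v) = (e u', e u') \<sqinter>\<^bsub>?Q\<^esub> (e v', e v')"
    then have "u = u'" "v = v'" by (simp_all add: Q_defs inj_on_eq_iff del: neq0_conv)
    then show "part L u \<sqinter>\<^bsub>F\<^esub> part L v = part L u' \<sqinter>\<^bsub>F\<^esub> part L v'" by simp
  qed (auto simp: Q_defs split: if_splits)
qed

section \<open>Decomposition of the free algebras\<close>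

lemma is_direct_sum_cong:
  assumes "is_direct_sum S I D" and eq: "\<And>i. i \<in> I \<Longrightarrow> D i = E i"
  shows "is_direct_sum S I E"
proof -
  have "sba_prod I (\<lambda>i. with_zero S (D i)) = sba_prod I (\<lambda>i. with_zero S (E i))"
    using eq by (intro sba_prod_cong) simp
  moreover have "map D ps = map E ps" if "set ps = I" for ps using eq that by simp
  ultimately have "carrier S = orthosum S (map E ps) \<and>
      (\<lambda>f. joins S (map f ps)) \<in> sba_iso (sba_prod I (\<lambda>i. with_zero S (E i))) S"
    if "distinct ps" "set ps = I" for ps
    using assms(1) that unfolding is_direct_sum_def by metis
  then show ?thesis using assms(1) eq unfolding is_direct_sum_def by simp
qed

lemma free_left_decomposition:
  fixes X :: "'v set"
  assumes X: "finite X" "card X = n"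
  shows "\<forall>p\<in>ordered_partitions X. primitive (P_left X p) \<and> P_left X p \<simeq> prim_left (card (fst p) + 1)"
    and "is_direct_sum (free_left_sba X) (ordered_partitions X) (D_left X)"
    and "free_left_sba X \<simeq> sba_prod {0..n} (\<lambda>k. sba_power (prim_left (k + 1)) (n choose k))"
proof -
  obtain us where us: "distinct us" "set us = X" using finite_distinct_list[OF X(1)] by blast
  interpret generated_sba "free_left_sba X" "free_gen left_handed_sba X" us
    using generated_sba_free_varieties(2)[OF us(1)] by (simp add: us(2))
  have D: "D_left X p = component (fst p)" if "p \<in> ordered_partitions X" for p
    using atom_class_left_handed[OF free_in_variety(2)] that by (simp add: us(2))
  have comp: "\<zero>\<^bsub>free_left_sba X\<^esub> \<notin> component L"
    "with_zero (free_left_sba X) (component L) \<simeq> prim_left (card L + 1)" if "L \<subseteq> X" for L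
    using free_left_component[OF us(1), of L] that by (simp_all add: us(2))
  have p: "fst p \<subseteq> X" "fst p \<noteq> {}" if "p \<in> ordered_partitions X" for p
    using that by (auto simp: ordered_partitions_def)
  note sum = direct_sum_components[unfolded us(2), OF comp(1)]
  show "\<forall>p\<in>ordered_partitions X. primitive (P_left X p) \<and> P_left X p \<simeq> prim_left (card (fst p) + 1)"
    using p comp primitive_component[unfolded us(2)] by (simp add: D)
  show "is_direct_sum (free_left_sba X) (ordered_partitions X) (D_left X)"
    by (rule is_direct_sum_cong[OF sum(1)]) (simp_all add: D)
  show "free_left_sba X \<simeq> sba_prod {0..n} (\<lambda>k. sba_power (prim_left (k + 1)) (n choose k))"
  proof (rule sba_prod_ordered_partitions[OF X sum(2)])
    show "closed_algebra (prim_left (0 + 1))" by unfold_locales (auto simp: prim_left_def)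
  qed (use comp p in \<open>auto simp: prim_left_def\<close>)
qed

lemma free_right_decomposition:
  fixes X :: "'v set"
  assumes X: "finite X" "card X = n"
  shows "\<forall>p\<in>ordered_partitions X. primitive (P_right X p) \<and> P_right X p \<simeq> prim_right (card (fst p) + 1)"
    and "is_direct_sum (free_right_sba X) (ordered_partitions X) (D_right X)"
    and "free_right_sba X \<simeq> sba_prod {0..n} (\<lambda>k. sba_power (prim_right (k + 1)) (n choose k))"
proof -
  obtain us where us: "distinct us" "set us = X" using finite_distinct_list[OF X(1)] by blast
  interpret generated_sba "free_right_sba X" "free_gen right_handed_sba X" us
    using generated_sba_free_varieties(3)[OF us(1)] by (simp add: us(2))
  have D: "D_right X p = component (fst p)" if "p \<in> ordered_partitions X" for p
    using atom_class_right_handed[OF free_in_variety(3)] that by (simp add: us(2))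
  have comp: "\<zero>\<^bsub>free_right_sba X\<^esub> \<notin> component L"
    "with_zero (free_right_sba X) (component L) \<simeq> prim_right (card L + 1)" if "L \<subseteq> X" for L
    using free_right_component[OF us(1), of L] that by (simp_all add: us(2))
  have p: "fst p \<subseteq> X" "fst p \<noteq> {}" if "p \<in> ordered_partitions X" for p
    using that by (auto simp: ordered_partitions_def)
  note sum = direct_sum_components[unfolded us(2), OF comp(1)]
  show "\<forall>p\<in>ordered_partitions X. primitive (P_right X p) \<and> P_right X p \<simeq> prim_right (card (fst p) + 1)"
    using p comp primitive_component[unfolded us(2)] by (simp add: D)
  show "is_direct_sum (free_right_sba X) (ordered_partitions X) (D_right X)"
    by (rule is_direct_sum_cong[OF sum(1)]) (simp_all add: D)
  show "free_right_sba X \<simeq> sba_prod {0..n} (\<lambda>k. sba_power (prim_right (k + 1)) (n choose k))"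
  proof (rule sba_prod_ordered_partitions[OF X sum(2)])
    show "closed_algebra (prim_right (0 + 1))" by unfold_locales (auto simp: prim_right_def)
  qed (use comp p in \<open>auto simp: prim_right_def\<close>)
qed

lemma prim_fibered_two: "prim_left 2 \<bullet> prim_right 2 \<simeq> prim_left 2"
  by (rule sba_isomorphicI[of fst _ _ "\<lambda>x. (x, x)"])
    (auto simp: sba_hom_def fibered_def sba_times_def prim_left_def prim_right_def)

text \<open>
  The factors for \<open>k = 0\<close> and \<open>k = 1\<close> are split off, since the fibered products
  \<open>prim_left 1 \<bullet> prim_right 1\<close> and \<open>prim_left 2 \<bullet> prim_right 2\<close> are isomorphic to \<open>alg_one\<close> and
  \<open>alg_two\<close>.
\<close>

lemma free_decomposition:
  fixes X :: "'v set"
  assumes X: "finite X" "card X = n" and n: "n \<ge> 1"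
  shows "\<exists>E. is_direct_sum (free_sba X) (ordered_partitions X) E \<and>
      (\<forall>p\<in>ordered_partitions X. with_zero (free_sba X) (E p) \<simeq>
        prim_left (card (fst p) + 1) \<bullet> prim_right (card (fst p) + 1))"
    and "free_sba X \<simeq>
        sba_power alg_one (n choose 0) \<times>\<^sub>S sba_power alg_two (n choose 1) \<times>\<^sub>S
        sba_prod {2..n} (\<lambda>k. sba_power (prim_left (k + 1) \<bullet> prim_right (k + 1)) (n choose k))"
proof -
  obtain us where us: "distinct us" "set us = X" using finite_distinct_list[OF X(1)] by blast
  interpret generated_sba "free_sba X" "free_gen skew_boolean_algebra X" us
    using generated_sba_free_varieties(1)[OF us(1)] by (simp add: us(2))
  let ?Q = "\<lambda>k. prim_left (k + 1) \<bullet> prim_right (k + 1)"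
  have comp: "\<zero>\<^bsub>free_sba X\<^esub> \<notin> component L"
    "with_zero (free_sba X) (component L) \<simeq> ?Q (card L)" if "L \<subseteq> X" "L \<noteq> {}" for L
    using free_component[OF us(1), of L] that by (simp_all add: us(2))
  have p: "fst p \<subseteq> X" "fst p \<noteq> {}" if "p \<in> ordered_partitions X" for p
    using that by (auto simp: ordered_partitions_def)
  note sum = direct_sum_components[unfolded us(2), OF comp(1)]
  show "\<exists>E. is_direct_sum (free_sba X) (ordered_partitions X) E \<and>
      (\<forall>p\<in>ordered_partitions X. with_zero (free_sba X) (E p) \<simeq> ?Q (card (fst p)))"
    using sum(1) comp(2)[OF p] by blast
  have one: "closed_algebra (?Q 0)" "carrier (?Q 0) = {\<zero>\<^bsub>?Q 0\<^esub>}"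
    "closed_algebra alg_one" "carrier alg_one = {\<zero>\<^bsub>alg_one\<^esub>}"
    by (auto simp: closed_algebra_def fibered_def sba_times_def prim_left_def prim_right_def)
  have power: "sba_power A m \<simeq> sba_power B m" if "A \<simeq> B" for A :: "(nat \<times> nat) sba" and B :: "nat sba" and m
    unfolding sba_power_def using that by (rule sba_prod_isomorphic)
  have "free_sba X \<simeq> sba_prod {0..n} (\<lambda>k. sba_power (?Q k) (n choose k))"
    using comp(2)[OF p] one by (intro sba_prod_ordered_partitions[OF X sum(2)]) auto
  also have "{0..n} = insert 0 (insert 1 {2..n})" using n by auto
  finally have "free_sba X \<simeq> sba_prod (insert 0 (insert 1 {2..n})) (\<lambda>k. sba_power (?Q k) (n choose k))" .
  moreover have "sba_prod (insert 0 (insert 1 {2..n})) (\<lambda>k. sba_power (?Q k) (n choose k)) \<simeq>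
      sba_power (?Q 0) (n choose 0) \<times>\<^sub>S sba_prod (insert 1 {2..n}) (\<lambda>k. sba_power (?Q k) (n choose k))"
    by (rule sba_prod_insert) simp
  moreover have "sba_prod (insert 1 {2..n}) (\<lambda>k. sba_power (?Q k) (n choose k)) \<simeq>
      sba_power (?Q 1) (n choose 1) \<times>\<^sub>S sba_prod {2..n} (\<lambda>k. sba_power (?Q k) (n choose k))"
    by (rule sba_prod_insert) simp
  moreover have "sba_power (?Q 0) (n choose 0) \<simeq> sba_power alg_one (n choose 0)"
    using one by (intro power trivial_sba_isomorphic)
  moreover have "sba_power (?Q 1) (n choose 1) \<simeq> sba_power alg_two (n choose 1)"
    using prim_fibered_two by (intro power) (simp add: numeral_2_eq_2)
  ultimately show "free_sba X \<simeq>
        sba_power alg_one (n choose 0) \<times>\<^sub>S sba_power alg_two (n choose 1) \<times>\<^sub>S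
        sba_prod {2..n} (\<lambda>k. sba_power (?Q k) (n choose k))"
    by (meson sba_isomorphic_trans sba_isomorphic_refl sba_times_isomorphic)
qed

theorem theorem4p3:
  fixes X :: "'v set" and n :: nat
  assumes "finite X" and "card X = n" and "n \<ge> 1"
  shows
    "((\<forall>p\<in>ordered_partitions X. primitive (P_left X p)) \<and>
      is_direct_sum (free_left_sba X) (ordered_partitions X) (D_left X) \<and>
      free_left_sba X \<simeq>
        sba_prod {0..n} (\<lambda>k. sba_power (prim_left (k + 1)) (n choose k))) \<and>
     ((\<forall>p\<in>ordered_partitions X. primitive (P_right X p)) \<and>
      is_direct_sum (free_right_sba X) (ordered_partitions X) (D_right X) \<and>
      free_right_sba X \<simeq>
        sba_prod {0..n} (\<lambda>k. sba_power (prim_right (k + 1)) (n choose k))) \<and>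
     ((\<forall>p\<in>ordered_partitions X. primitive (P_left X p \<bullet> P_right X p)) \<and>
      (\<exists>E. is_direct_sum (free_sba X) (ordered_partitions X) E \<and>
         (\<forall>p\<in>ordered_partitions X.
            with_zero (free_sba X) (E p) \<simeq> P_left X p \<bullet> P_right X p)) \<and>
      free_sba X \<simeq>
        sba_power alg_one (n choose 0) \<times>\<^sub>S sba_power alg_two (n choose 1) \<times>\<^sub>S
        sba_prod {2..n} (\<lambda>k. sba_power (prim_left (k + 1) \<bullet> prim_right (k + 1)) (n choose k)))"
proof -
  note left = free_left_decomposition[OF assms(1,2)]
  note right = free_right_decomposition[OF assms(1,2)]
  note both = free_decomposition[OF assms]
  have prim: "primitive (P_left X p \<bullet> P_right X p)" if "p \<in> ordered_partitions X" for p
    using left(1) right(1) that by (intro primitive_fibered) auto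
  have model: "prim_left (card (fst p) + 1) \<bullet> prim_right (card (fst p) + 1) \<simeq>
      P_left X p \<bullet> P_right X p" if p: "p \<in> ordered_partitions X" for p
  proof -
    have "P_left X p \<bullet> P_right X p \<simeq> prim_left (card (fst p) + 1) \<bullet> prim_right (card (fst p) + 1)"
      using left(1) right(1) p
      by (intro fibered_isomorphic) (auto simp: with_zero_def)
    then show ?thesis by (rule sba_isomorphic_sym[OF primitive_closed[OF prim[OF p]]])
  qed
  obtain E where E: "is_direct_sum (free_sba X) (ordered_partitions X) E"
    "\<And>p. p \<in> ordered_partitions X \<Longrightarrow> with_zero (free_sba X) (E p) \<simeq>
        prim_left (card (fst p) + 1) \<bullet> prim_right (card (fst p) + 1)"
    using both(1) by blast
  have "\<forall>p\<in>ordered_partitions X. with_zero (free_sba X) (E p) \<simeq> P_left X p \<bullet> P_right X p"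
    using sba_isomorphic_trans[OF E(2) model] by blast
  then show ?thesis
    using left right prim E(1) both(2) by blast
qed

end
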